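(* Let $(\Omega,\mathcal{F})$ be a standard Borel space and let $E\subset\Omega\times\Omega$ be a measurable equivalence relation. Then, for all $\mu,\nu\in\mathcal{P}(\mathcal{F})$, $$\inf_{P\in\Gamma(\mu,\nu)}(1-P(E))=\|\mu-\nu\|_{\mathcal{G}_1}.$$
   Context: A measurable space $(\Omega,\mathcal{F})$ is a standard Borel space if $\mathcal{F}$ is the Borel $\sigma$-field of some Polish (separable, completely metrizable) topology on $\Omega$. $\mathcal{P}(\mathcal{F})$ is the set of all probability measures on $\mathcal{F}$. A measurable equivalence relation is a set $E\in\mathcal{F}\otimes\mathcal{F}$ such that the relation $x\sim y\Leftrightarrow(x,y)\in E$ is reflexive, symmetric and transitive on $\Omega$. $\Gamma(\mu,\nu)$ is the set of all ($\sigma$-additive) probability measures $P$ on $\mathcal{F}\otimes\mathcal{F}$ with marginals $\mu$ and $\nu$, i.e. $P(A\times\Omega)=\mu(A)$ and $P(\Omega\times A)=\nu(A)$ for all $A\in\mathcal{F}$. $\widehat{\mathcal{F}}=\bigcap_{\mu\in\mathcal{P}(\mathcal{F})}\overline{\mathcal{F}}^{\mu}$ is the universally measurable $\sigma$-field with respect to $\mathcal{F}$, where $\overline{\mathcal{F}}^{\mu}$ is the completion of $\mathcal{F}$ with respect to $\mu$. For $\mu\in\mathcal{P}(\mathcal{F})$, the unique extension of $\mu$ to $\widehat{\mathcal{F}}$ is still denoted by $\mu$. Define $$\mathcal{G}_1=\{A\in\widehat{\mathcal{F}}:\ 1_A(x)=1_A(y)\text{ for all }(x,y)\in E\}.$$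 For a $\sigma$-field $\mathcal{G}\subset\widehat{\mathcal{F}}$, $\|\mu-\nu\|_{\mathcal{G}}=\sup_{A\in\mathcal{G}}|\mu(A)-\nu(A)|$. *)

theory Defs
  imports "HOL-Probability.Probability"
begin

text \<open>
  A \<open>\<sigma>\<close>-field \<open>\<F>\<close> on \<open>\<Omega>\<close> is carried by a measure space \<open>M\<close> with \<open>space M = \<Omega>\<close> and
  \<open>sets M = \<F>\<close>; the measure of \<open>M\<close> itself is irrelevant. The probability measures on \<open>\<F>\<close> are
  the elements of \<open>space (prob_algebra M)\<close>. The library has Polish spaces only as a type class,
  so the topology is taken here as a value of type \<open>topology\<close> on the carrier.
\<close>

definition standard_borel_space :: "'a measure \<Rightarrow> bool" where
  "standard_borel_space M \<longleftrightarrow>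
     (\<exists>X. completely_metrizable_space X \<and> separable_space X \<and> topspace X = space M \<and>
          sets M = sigma_sets (space M) {U. openin X U})"

definition measurable_equiv :: "'a measure \<Rightarrow> ('a \<times> 'a) set \<Rightarrow> bool" where
  "measurable_equiv M E \<longleftrightarrow> E \<in> sets (M \<Otimes>\<^sub>M M) \<and> equiv (space M) E"

definition couplings :: "'a measure \<Rightarrow> 'a measure \<Rightarrow> 'a measure \<Rightarrow> ('a \<times> 'a) measure set" where
  "couplings M \<mu> \<nu> =
     {P \<in> space (prob_algebra (M \<Otimes>\<^sub>M M)).
        \<forall>A\<in>sets M. measure P (A \<times> space M) = measure \<mu> A \<and> measure P (space M \<times> A) = measure \<nu> A}"

text \<open>
  The intersection with \<open>Pow (space M)\<close> only matters when \<open>space M\<close> is empty: there is no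
  probability measure then, and the bare intersection would be \<open>UNIV\<close>.
\<close>

definition universal_sets :: "'a measure \<Rightarrow> 'a set set" where
  "universal_sets M = Pow (space M) \<inter> (\<Inter>\<mu>\<in>space (prob_algebra M). sets (completion \<mu>))"

definition invariant_universal_sets :: "'a measure \<Rightarrow> ('a \<times> 'a) set \<Rightarrow> 'a set set" where
  "invariant_universal_sets M E =
     {A \<in> universal_sets M. \<forall>(x, y)\<in>E. indicator A x = (indicator A y :: real)}"

text \<open>
  The extension of a probability measure \<open>\<mu>\<close> to the universally measurable sets is the restriction
  of \<open>completion \<mu>\<close>. The definition below is meant for \<open>\<G> \<subseteq> universal_sets M\<close> and probability
  measures \<open>\<mu>\<close>, \<open>\<nu>\<close> on \<open>M\<close>; the supremum is then over a bounded set of reals.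
\<close>

definition variation_dist :: "'a set set \<Rightarrow> 'a measure \<Rightarrow> 'a measure \<Rightarrow> real" where
  "variation_dist \<G> \<mu> \<nu> =
     (SUP A\<in>\<G>. \<bar>measure (completion \<mu>) A - measure (completion \<nu>) A\<bar>)"

end

theory Submission
  imports Defs
begin

text \<open>
  The bound \<open>\<ge>\<close> holds because a coupling gives mass at most \<open>1 - P(E)\<close> to the pairs that an
  invariant set separates. For \<open>\<le>\<close>, let \<open>c(E)\<close> be the infimum of \<open>\<mu>(C) + \<nu>(D)\<close> over the Borel
  sets with \<open>E \<subseteq> C \<times> \<Omega> \<union> \<Omega> \<times> D\<close>. In such a cover the saturations of the complements of \<open>C\<close>
  and \<open>D\<close> are disjoint analytic sets, and iterated Lusin separation gives an invariant Borel set
  \<open>U\<close> between them, so that \<open>\<mu>(C) + \<nu>(D) \<ge> 1 - (\<mu>(U) - \<nu>(U))\<close>. It remains to find couplings with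
  \<open>P(E)\<close> close to \<open>c(E)\<close>. For finite unions of rectangles this is the duality between matchings
  and vertex covers. The functional \<open>c\<close> is continuous along increasing sequences, so, as in Choquet's
  capacitability theorem, \<open>E\<close> contains the intersection of the closures of a decreasing sequence of
  open sets on which \<open>c\<close> stays large. A cluster point of the corresponding couplings is finitely
  additive with countably additive regular marginals, hence it extends to a measure. A standard Borel
  space is a Borel retract of the Baire space, where all of this takes place.
\<close>

text \<open>The obstacle to attaining \<open>c(E)\<close> is that \<open>E\<close> is only Borel:
  \<open>P(E)\<close> is not semicontinuous in \<open>P\<close>, and a limit of good couplings may
  lose \<open>E\<close>. Closed sets are safe, and open sets are where finite unions of rectangles
  reach the value of \<open>c\<close>. Hence the open sets whose closures intersect inside
  \<open>E\<close>. Choquet's theorem also asks for continuity along decreasing compact sets; the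
  limit of the couplings themselves takes the place of that half.

  Limits are formed among finitely additive set functions on all Borel sets, so that compactness is
  Tychonoff's theorem. The limit \<pi> and the measure \<open>P\<close> that extends it are known to
  agree only on finite unions of rectangles. On open sets \<open>P\<close> is at most \<pi>, hence
  on closed sets at least \<pi>, which is the direction wanted.

  The separating sets are Borel. Universal measurability enters only in the easy bound, where an
  invariant set is squeezed between measurable sets that need not be invariant.\<close>

subsection \<open>Matchings and covers in weighted bipartite graphs\<close>

text \<open>Induction on the edges. As much mass \<open>t\<close> is moved along the new edge \<open>e\<close> as is possible with the
  optimal cover losing no more than \<open>t\<close>. Afterwards one endpoint of \<open>e\<close> is exhausted or an optimal
  cover contains both endpoints, and in either case deleting \<open>e\<close> leaves the optimal cost unchanged.\<close>

lemma bipartite_duality_subcoupling: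
  fixes a :: "'i \<Rightarrow> real" and b :: "'j \<Rightarrow> real"
  assumes "finite I" "finite J" "K \<subseteq> I \<times> J"
    and "\<And>i. i \<in> I \<Longrightarrow> 0 \<le> a i" "\<And>j. j \<in> J \<Longrightarrow> 0 \<le> b j"
  obtains p C D where "\<And>i j. 0 \<le> p i j" "\<And>i j. (i, j) \<notin> K \<Longrightarrow> p i j = 0"
    "\<And>i. i \<in> I \<Longrightarrow> (\<Sum>j\<in>J. p i j) \<le> a i" "\<And>j. j \<in> J \<Longrightarrow> (\<Sum>i\<in>I. p i j) \<le> b j"
    "C \<subseteq> I" "D \<subseteq> J" "K \<subseteq> C \<times> UNIV \<union> UNIV \<times> D"
    "sum a C + sum b D \<le> (\<Sum>i\<in>I. \<Sum>j\<in>J. p i j)"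
proof -
  have "finite K" using assms(1-3) by (meson finite_SigmaI finite_subset)
  then have "K \<subseteq> I \<times> J \<Longrightarrow> (\<forall>i\<in>I. 0 \<le> a i) \<Longrightarrow> (\<forall>j\<in>J. 0 \<le> b j) \<Longrightarrow>
    \<exists>p C D. (\<forall>i j. 0 \<le> p i j) \<and> (\<forall>i j. (i, j) \<notin> K \<longrightarrow> p i j = 0) \<and>
      (\<forall>i\<in>I. (\<Sum>j\<in>J. p i j) \<le> a i) \<and> (\<forall>j\<in>J. (\<Sum>i\<in>I. p i j) \<le> b j) \<and>
      C \<subseteq> I \<and> D \<subseteq> J \<and> K \<subseteq> C \<times> UNIV \<union> UNIV \<times> D \<and>
      sum a C + sum b D \<le> (\<Sum>i\<in>I. \<Sum>j\<in>J. p i j)"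
  proof (induction K arbitrary: a b rule: finite_induct)
    case empty
    then show ?case by (intro exI[of _ "\<lambda>_ _. 0"] exI[of _ "{}"]) auto
  next
    case (insert e K)
    obtain i0 j0 where e: "e = (i0, j0)" by force
    have ij: "i0 \<in> I" "j0 \<in> J" and K: "K \<subseteq> I \<times> J" using insert.prems e by auto
    define cov where "cov = {(C, D). C \<subseteq> I \<and> D \<subseteq> J \<and> insert e K \<subseteq> C \<times> UNIV \<union> UNIV \<times> D}"
    define w where "w = (\<lambda>(a :: 'i \<Rightarrow> real) (b :: 'j \<Rightarrow> real) (C, D). sum a C + sum b D)"
    have cov_fin: "finite cov"
      by (rule finite_subset[of _ "Pow I \<times> Pow J"]) (auto simp: cov_def assms)
    have IJ: "(I, J) \<in> cov" using insert.prems by (auto simp: cov_def)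
    define c where "c = Min (w a b ` cov)"
    have c_le: "c \<le> w a b x" if "x \<in> cov" for x
      using that cov_fin by (simp add: c_def)
    have "c \<in> w a b ` cov" unfolding c_def using cov_fin IJ by (intro Min_in) auto
    then obtain CD where CD: "CD \<in> cov" "w a b CD = c" by auto
    \<comment> \<open>Every cover meets \<open>e\<close>, so moving \<open>t\<close> along
      \<open>e\<close> lowers its weight by \<open>t\<close>, or by \<open>2 * t\<close> if it
      contains both endpoints. Only covers in \<open>cov2\<close> can fall below
      \<open>c - t\<close>, and their slack \<open>m\<close> limits \<open>t\<close>.\<close>
    define cov2 where "cov2 = {(C, D) \<in> cov. i0 \<in> C \<and> j0 \<in> D}"
    have cov2: "finite cov2" "(I, J) \<in> cov2" "cov2 \<subseteq> cov"
      using IJ ij by (auto simp: cov2_def intro: finite_subset[OF _ cov_fin])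
    define m where "m = Min ((\<lambda>x. w a b x - c) ` cov2)"
    have m_le: "m \<le> w a b x - c" if "x \<in> cov2" for x
      using that cov2 by (simp add: m_def)
    have "m \<in> (\<lambda>x. w a b x - c) ` cov2" unfolding m_def using cov2 by (intro Min_in) auto
    then obtain CD2 where CD2: "CD2 \<in> cov2" "w a b CD2 - c = m" by auto
    have "0 \<le> m" using c_le[of CD2] CD2 cov2(3) by auto
    define t where "t = min m (min (a i0) (b j0))"
    have t: "0 \<le> t" "t \<le> m" "t \<le> a i0" "t \<le> b j0"
      using \<open>0 \<le> m\<close> insert.prems ij by (auto simp: t_def)
    define a' where "a' = (\<lambda>i. a i - (if i = i0 then t else 0))"
    define b' where "b' = (\<lambda>j. b j - (if j = j0 then t else 0))"
    have "\<forall>i\<in>I. 0 \<le> a' i" "\<forall>j\<in>J. 0 \<le> b' j"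
      using insert.prems t by (auto simp: a'_def b'_def)
    from insert.IH[OF K this] obtain p C D where p: "\<And>i j. 0 \<le> p i j"
      "\<And>i j. (i, j) \<notin> K \<Longrightarrow> p i j = 0"
      "\<And>i. i \<in> I \<Longrightarrow> (\<Sum>j\<in>J. p i j) \<le> a' i" "\<And>j. j \<in> J \<Longrightarrow> (\<Sum>i\<in>I. p i j) \<le> b' j"
      and CD': "C \<subseteq> I" "D \<subseteq> J" "K \<subseteq> C \<times> UNIV \<union> UNIV \<times> D"
      "sum a' C + sum b' D \<le> (\<Sum>i\<in>I. \<Sum>j\<in>J. p i j)"
      by blast
    have fin: "finite C" "finite D" using CD' assms finite_subset by auto
    have sa: "sum a' C = sum a C - (if i0 \<in> C then t else 0)"
      and sb: "sum b' D = sum b D - (if j0 \<in> D then t else 0)"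
      using fin by (auto simp: a'_def b'_def sum_subtractf)
    have key: "c - t \<le> sum a' C + sum b' D"
    proof (cases "i0 \<in> C \<or> j0 \<in> D")
      case True
      then have 1: "(C, D) \<in> cov" using CD' e by (auto simp: cov_def)
      then have "c \<le> sum a C + sum b D" using c_le[of "(C, D)"] by (simp add: w_def)
      moreover have "t \<le> sum a C + sum b D - c" if "i0 \<in> C" "j0 \<in> D"
        using m_le[of "(C, D)"] that 1 t by (simp add: w_def cov2_def)
      ultimately show ?thesis unfolding sa sb using True by auto
    next
      case False
      then have w: "sum a' C + sum b' D = sum a C + sum b D" by (simp add: sa sb)
      consider "t = a i0" | "t = b j0" | "t = m" unfolding t_def by linarith
      then show ?thesis
      proof cases
        case 1
        \<comment> \<open>The weight of \<open>i0\<close> under \<open>a\<close> is exactly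
          \<open>t\<close>, so covering \<open>e\<close> as well costs only
          \<open>t\<close>.\<close>
        have "(insert i0 C, D) \<in> cov" using CD' e ij by (auto simp: cov_def)
        from c_le[OF this] show ?thesis using False fin 1 w by (simp add: w_def)
      next
        case 2
        have "(C, insert j0 D) \<in> cov" using CD' e ij by (auto simp: cov_def)
        from c_le[OF this] show ?thesis using False fin 2 w by (simp add: w_def)
      next
        case 3
        obtain C2 D2 where 2: "CD2 = (C2, D2)" by force
        have C2: "C2 \<subseteq> I" "D2 \<subseteq> J" "insert e K \<subseteq> C2 \<times> UNIV \<union> UNIV \<times> D2" "i0 \<in> C2" "j0 \<in> D2"
          using CD2(1) by (auto simp: 2 cov2_def cov_def)
        have fin2: "finite C2" "finite D2" using C2 assms finite_subset by auto
        \<comment> \<open>Uncrossing: \<open>i0\<close> in \<open>C2\<close> and \<open>j0\<close>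
          in \<open>D2\<close> make both pairs cover \<open>e\<close>. Their weights add up to those
          of \<open>(C, D)\<close> and \<open>CD2\<close>, the latter being
          \<open>c + m\<close>.\<close>
        have "(C \<union> C2, D \<inter> D2) \<in> cov" "(C \<inter> C2, D \<union> D2) \<in> cov"
          using CD' C2 e by (auto simp: cov_def)
        from this[THEN c_le] have "2 * c \<le> (sum a (C \<union> C2) + sum a (C \<inter> C2)) + (sum b (D \<union> D2) + sum b (D \<inter> D2))"
          by (simp add: w_def)
        also have "\<dots> = (sum a C + sum b D) + w a b CD2"
          using sum.union_inter[OF fin(1) fin2(1), of a] sum.union_inter[OF fin(2) fin2(2), of b]
          by (simp add: w_def 2)
        finally show ?thesis using w 3 CD2(2) by simp
      qed
    qed
    define q where "q = (\<lambda>i j. p i j + (if i = i0 \<and> j = j0 then t else 0))"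
    have q1: "(\<Sum>j\<in>J. q i j) = (\<Sum>j\<in>J. p i j) + (if i = i0 then t else 0)" for i
      using ij assms(2) by (simp add: q_def sum.distrib)
    have q2: "(\<Sum>i\<in>I. q i j) = (\<Sum>i\<in>I. p i j) + (if j = j0 then t else 0)" for j
      using ij assms(1) by (simp add: q_def sum.distrib)
    have q3: "(\<Sum>i\<in>I. \<Sum>j\<in>J. q i j) = (\<Sum>i\<in>I. \<Sum>j\<in>J. p i j) + t"
      using ij assms(1) by (simp add: q1 sum.distrib)
    have "\<forall>i\<in>I. (\<Sum>j\<in>J. q i j) \<le> a i" "\<forall>j\<in>J. (\<Sum>i\<in>I. q i j) \<le> b j"
      unfolding q1 q2 using p(3,4) by (fastforce simp: a'_def b'_def)+
    moreover have "\<forall>i j. 0 \<le> q i j" "\<forall>i j. (i, j) \<notin> insert e K \<longrightarrow> q i j = 0"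
      using p(1,2) t(1) e by (auto simp: q_def)
    moreover have "w a b CD \<le> (\<Sum>i\<in>I. \<Sum>j\<in>J. q i j)"
      using CD(2) key CD'(4) q3 by simp
    ultimately show ?case using CD(1)
      by (intro exI[of _ q] exI[of _ "fst CD"] exI[of _ "snd CD"]) (auto simp: w_def cov_def split: prod.splits)
  qed
  from this[OF assms(3)] assms(4,5) obtain p C D where
    "(\<forall>i j. 0 \<le> p i j) \<and> (\<forall>i j. (i, j) \<notin> K \<longrightarrow> p i j = 0) \<and>
      (\<forall>i\<in>I. (\<Sum>j\<in>J. p i j) \<le> a i) \<and> (\<forall>j\<in>J. (\<Sum>i\<in>I. p i j) \<le> b j) \<and>
      C \<subseteq> I \<and> D \<subseteq> J \<and> K \<subseteq> C \<times> UNIV \<union> UNIV \<times> D \<and>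
      sum a C + sum b D \<le> (\<Sum>i\<in>I. \<Sum>j\<in>J. p i j)"
    by blast
  then show ?thesis using that[of p C D] by blast
qed

text \<open>The missing mass is distributed as the product of the residual marginals.\<close>

lemma bipartite_duality:
  fixes a :: "'i \<Rightarrow> real" and b :: "'j \<Rightarrow> real"
  assumes fin: "finite I" "finite J" and K: "K \<subseteq> I \<times> J"
    and nonneg: "\<And>i. i \<in> I \<Longrightarrow> 0 \<le> a i" "\<And>j. j \<in> J \<Longrightarrow> 0 \<le> b j"
    and eq: "sum a I = sum b J"
  obtains p C D where "\<And>i j. i \<in> I \<Longrightarrow> j \<in> J \<Longrightarrow> 0 \<le> p i j"
    "\<And>i. i \<in> I \<Longrightarrow> (\<Sum>j\<in>J. p i j) = a i" "\<And>j. j \<in> J \<Longrightarrow> (\<Sum>i\<in>I. p i j) = b j"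
    "C \<subseteq> I" "D \<subseteq> J" "K \<subseteq> C \<times> UNIV \<union> UNIV \<times> D"
    "sum a C + sum b D \<le> (\<Sum>(i, j)\<in>K. p i j)"
proof -
  obtain p C D where p: "\<And>i j. 0 \<le> p i j" "\<And>i j. (i, j) \<notin> K \<Longrightarrow> p i j = 0"
    "\<And>i. i \<in> I \<Longrightarrow> (\<Sum>j\<in>J. p i j) \<le> a i" "\<And>j. j \<in> J \<Longrightarrow> (\<Sum>i\<in>I. p i j) \<le> b j"
    and CD: "C \<subseteq> I" "D \<subseteq> J" "K \<subseteq> C \<times> UNIV \<union> UNIV \<times> D"
    "sum a C + sum b D \<le> (\<Sum>i\<in>I. \<Sum>j\<in>J. p i j)"
    by (rule bipartite_duality_subcoupling[OF fin K nonneg]) blast+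
  define r where "r = (\<lambda>i. a i - (\<Sum>j\<in>J. p i j))"
  define s where "s = (\<lambda>j. b j - (\<Sum>i\<in>I. p i j))"
  have r0: "0 \<le> r i" if "i \<in> I" for i using p(3)[OF that] by (simp add: r_def)
  have s0: "0 \<le> s j" if "j \<in> J" for j using p(4)[OF that] by (simp add: s_def)
  have rs: "sum r I = sum s J"
    using eq sum.swap[of p J I] by (simp add: r_def s_def sum_subtractf)
  \<comment> \<open>If no mass is missing, all residuals vanish and the quotient is \<open>0\<close>
    by the convention for division by zero; hence the separate cases \<open>sum r I = 0\<close>
    below.\<close>
  define q where "q = (\<lambda>i j. p i j + r i * s j / sum r I)"
  have q0: "p i j \<le> q i j" if "i \<in> I" "j \<in> J" for i j
    using r0 s0 that by (simp add: q_def sum_nonneg)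
  have "(\<Sum>j\<in>J. q i j) = a i" if "i \<in> I" for i
  proof (cases "sum r I = 0")
    case True
    then have "r i = 0" using sum_nonneg_eq_0_iff[OF fin(1), of r] r0 that by auto
    then show ?thesis by (simp add: q_def r_def)
  next
    case False
    have "(\<Sum>j\<in>J. q i j) = (\<Sum>j\<in>J. p i j) + r i * sum s J / sum r I"
      by (simp add: q_def sum.distrib sum_distrib_left sum_divide_distrib)
    then show ?thesis using False rs by (simp add: r_def)
  qed
  moreover have "(\<Sum>i\<in>I. q i j) = b j" if "j \<in> J" for j
  proof (cases "sum r I = 0")
    case True
    then have "s j = 0" using sum_nonneg_eq_0_iff[OF fin(2), of s] s0 that rs by auto
    then show ?thesis by (simp add: q_def s_def)
  next
    case False
    have "(\<Sum>i\<in>I. q i j) = (\<Sum>i\<in>I. p i j) + sum r I * s j / sum r I"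
      by (simp add: q_def sum.distrib sum_distrib_right sum_divide_distrib)
    then show ?thesis using False by (simp add: s_def)
  qed
  moreover have "0 \<le> q i j" if "i \<in> I" "j \<in> J" for i j
    using q0[OF that] p(1)[of i j] by linarith
  moreover have "(\<Sum>i\<in>I. \<Sum>j\<in>J. p i j) \<le> (\<Sum>(i, j)\<in>K. q i j)"
  proof -
    have "(\<Sum>i\<in>I. \<Sum>j\<in>J. p i j) = (\<Sum>(i, j)\<in>I \<times> J. p i j)"
      by (simp add: sum.cartesian_product)
    also have "\<dots> = (\<Sum>(i, j)\<in>K. p i j)"
      using K p(2) fin by (intro sum.mono_neutral_right) auto
    also have "\<dots> \<le> (\<Sum>(i, j)\<in>K. q i j)" using q0 K by (intro sum_mono) auto
    finally show ?thesis .
  qed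
  ultimately show ?thesis using that[of q C D] CD by force
qed

subsection \<open>Analytic sets\<close>

text \<open>Projections of closed sets along the Baire space. In this form the empty set is no
  special case, and countable unions and intersections reduce to recoding the witnessing
  sequences.\<close>

definition analytic :: "'a::topological_space set \<Rightarrow> bool" where
  "analytic A \<longleftrightarrow> (\<exists>F :: ('a \<times> (nat \<Rightarrow> nat)) set. closed F \<and> A = fst ` F)"

lemma continuous_on_Pair_reindex:
  "continuous_on UNIV (\<lambda>z :: 'b::topological_space \<times> ('i \<Rightarrow> 'a::topological_space). (fst z, \<lambda>k. snd z (f k)))"
  by (intro continuous_on_Pair continuous_intros continuous_on_compose2[OF continuous_on_product_coordinates]) auto

lemma analytic_closed: "closed A \<Longrightarrow> analytic A"
  unfolding analytic_def by (intro exI[of _ "A \<times> UNIV"]) (auto simp: closed_Times)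

lemma analytic_UN:
  assumes "\<And>i::nat. analytic (A i)"
  shows "analytic (\<Union>i. A i)"
proof -
  obtain F :: "nat \<Rightarrow> ('a \<times> (nat \<Rightarrow> nat)) set" where F: "\<And>i. closed (F i)" "\<And>i. A i = fst ` F i"
    using assms unfolding analytic_def by metis
  \<comment> \<open>Entry \<open>0\<close> chooses the index and the shifted sequence is the
    witness. The choice is written as a conjunction of implications, one for each \<open>i\<close>,
    so that \<open>G\<close> is an intersection of closed sets.\<close>
  define G where "G = (\<Inter>i. {z :: 'a \<times> (nat \<Rightarrow> nat). snd z 0 \<in> - {i}} \<union> {z. (fst z, \<lambda>k. snd z (Suc k)) \<in> F i})"
  have "closed G" unfolding G_def
  proof (intro closed_INT ballI closed_Un)
    fix i :: nat
    show "closed {z :: 'a \<times> (nat \<Rightarrow> nat). snd z 0 \<in> - {i}}"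
    proof -
      have "closed (- {i})" by (simp add: closed_def Topological_Spaces.open_discrete)
      from closed_vimage[OF this continuous_on_product_then_coordinatewise[OF continuous_on_snd[OF continuous_on_id]]]
      show ?thesis by (simp only: vimage_def)
    qed
    show "closed {z. (fst z, \<lambda>k. snd z (Suc k)) \<in> F i}"
      using closed_vimage[OF F(1)[of i] continuous_on_Pair_reindex[of Suc]] by (simp add: vimage_def)
  qed
  moreover have "(\<Union>i. A i) = fst ` G"
  proof (intro set_eqI iffI)
    fix x assume "x \<in> (\<Union>i. A i)"
    then obtain i \<sigma> where "(x, \<sigma>) \<in> F i" using F(2) by auto
    then have "(x, case_nat i \<sigma>) \<in> G" by (auto simp: G_def)
    then show "x \<in> fst ` G" by force
  next
    fix x assume "x \<in> fst ` G"
    then obtain \<sigma> where "(x, \<sigma>) \<in> G" by auto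
    then have "(x, \<lambda>k. \<sigma> (Suc k)) \<in> F (\<sigma> 0)" by (auto simp: G_def)
    then show "x \<in> (\<Union>i. A i)" using F(2) by force
  qed
  ultimately show ?thesis unfolding analytic_def by blast
qed

lemma analytic_INT:
  assumes "\<And>i::nat. analytic (A i)"
  shows "analytic (\<Inter>i. A i)"
proof -
  obtain F :: "nat \<Rightarrow> ('a \<times> (nat \<Rightarrow> nat)) set" where F: "\<And>i. closed (F i)" "\<And>i. A i = fst ` F i"
    using assms unfolding analytic_def by metis
  \<comment> \<open>One sequence holds a witness for every \<open>i\<close>, namely its entries at
    \<open>prod_encode (i, k)\<close> with \<open>k\<close> varying.\<close>
  define G where "G = (\<Inter>i. {z. (fst z, \<lambda>k. snd z (prod_encode (i, k))) \<in> F i})"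
  have "closed G" unfolding G_def
  proof (intro closed_INT ballI)
    fix i
    show "closed {z. (fst z, \<lambda>k. snd z (prod_encode (i, k))) \<in> F i}"
      using closed_vimage[OF F(1)[of i] continuous_on_Pair_reindex[of "\<lambda>k. prod_encode (i, k)"]]
      by (simp add: vimage_def)
  qed
  moreover have "(\<Inter>i. A i) = fst ` G"
  proof (intro set_eqI iffI)
    fix x assume "x \<in> (\<Inter>i. A i)"
    then have "\<forall>i. \<exists>\<sigma>. (x, \<sigma>) \<in> F i" using F(2) by fastforce
    then obtain \<sigma> where "\<And>i. (x, \<sigma> i) \<in> F i" by metis
    then have "(x, \<lambda>m. case prod_decode m of (i, k) \<Rightarrow> \<sigma> i k) \<in> G" by (auto simp: G_def)
    then show "x \<in> fst ` G" by force
  next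
    fix x assume "x \<in> fst ` G"
    then obtain \<sigma> where "(x, \<sigma>) \<in> G" by auto
    then have "(x, \<lambda>k. \<sigma> (prod_encode (i, k))) \<in> F i" for i by (auto simp: G_def)
    then show "x \<in> (\<Inter>i. A i)" using F(2) by force
  qed
  ultimately show ?thesis unfolding analytic_def by blast
qed

lemma analytic_open:
  fixes U :: "'a::metric_space set"
  assumes "open U"
  shows "analytic U"
\<comment> \<open>\<open>infdist x {}\<close> is \<open>0\<close>, so positive distance to the
  complement characterises \<open>U\<close> only when the complement is nonempty.\<close>
proof (cases "U = UNIV")
  case True
  then show ?thesis by (simp add: analytic_closed)
next
  case False
  then have ne: "- U \<noteq> {}" by auto
  have eq: "x \<in> U \<longleftrightarrow> (\<exists>n::nat. 1 / Suc n \<le> infdist x (- U))" for x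
  proof -
    have "x \<in> U \<longleftrightarrow> 0 < infdist x (- U)"
      using in_closed_iff_infdist_zero[of "- U" x] infdist_nonneg[of x "- U"] assms ne
      by (auto simp: closed_Compl order_less_le)
    also have "\<dots> \<longleftrightarrow> (\<exists>n::nat. 1 / Suc n \<le> infdist x (- U))"
    proof
      assume "0 < infdist x (- U)"
      then obtain n where "1 / Suc n < infdist x (- U)" by (rule nat_approx_posE)
      then show "\<exists>n::nat. 1 / Suc n \<le> infdist x (- U)" by (intro exI[of _ n]) simp
    next
      assume "\<exists>n::nat. 1 / Suc n \<le> infdist x (- U)"
      then obtain n :: nat where "1 / Suc n \<le> infdist x (- U)" ..
      moreover have "0 < 1 / real (Suc n)" by simp
      ultimately show "0 < infdist x (- U)" by (rule less_le_trans[rotated])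
    qed
    finally show ?thesis .
  qed
  have "U = (\<Union>n. {x. 1 / real (Suc n) \<le> infdist x (- U)})"
    by (rule set_eqI) (simp only: eq UN_iff mem_Collect_eq bex_UNIV)
  also have "analytic \<dots>"
    by (intro analytic_UN analytic_closed closed_Collect_le continuous_intros)
  finally show ?thesis .
qed

lemma analytic_borel:
  fixes A :: "'a::metric_space set"
  assumes "A \<in> sets borel"
  shows "analytic A"
proof -
  from assms have "A \<in> sigma_sets UNIV {S. open S}" by (simp add: borel_def)
  \<comment> \<open>Complements of analytic sets need not be analytic, so the complement is part of
    the induction claim: complementation swaps the conjuncts, and unions turn into
    intersections.\<close>
  then have "analytic A \<and> analytic (- A)"
  proof (induction rule: sigma_sets.induct)
    case (Union A)
    then show ?case by (auto simp: Compl_UN intro: analytic_UN analytic_INT)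
  qed (auto intro: analytic_open analytic_closed simp: Compl_eq_Diff_UNIV[symmetric] closed_Compl)
  then show ?thesis ..
qed

text \<open>The library has no metric on \<open>nat\<close>; the Baire space as a Polish space is \<open>nat \<Rightarrow> nat discrete\<close>.\<close>

lemma analytic_image_snd:
  fixes S :: "((nat \<Rightarrow> nat discrete) \<times> 'a::topological_space) set"
  assumes "analytic S"
  shows "analytic (snd ` S)"
proof -
  obtain F :: "(((nat \<Rightarrow> nat discrete) \<times> 'a) \<times> (nat \<Rightarrow> nat)) set" where F: "closed F" "S = fst ` F"
    using assms unfolding analytic_def by auto
  \<comment> \<open>Even entries spell out the point that is projected away, odd entries its old
    witness.\<close>
  let ?f = "\<lambda>z :: 'a \<times> (nat \<Rightarrow> nat). ((\<lambda>n. discrete (snd z (2 * n)), fst z), \<lambda>n. snd z (2 * n + 1))"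
  have c: "continuous_on UNIV (\<lambda>z :: 'a \<times> (nat \<Rightarrow> nat). snd z i)" for i
    by (rule continuous_on_product_then_coordinatewise[OF continuous_on_snd[OF continuous_on_id]])
  have "continuous_on UNIV ?f"
    by (intro continuous_on_Pair continuous_on_coordinatewise_then_product c continuous_on_fst
        continuous_on_id continuous_on_compose2[OF Topological_Spaces.continuous_on_discrete[of UNIV discrete] c] subset_UNIV)
  then have "closed (?f -` F)" using F(1) by (rule closed_vimage[rotated])
  moreover have "snd ` S = fst ` (?f -` F)"
  proof (intro set_eqI iffI)
    fix y assume "y \<in> snd ` S"
    then obtain x \<sigma> where "((x, y), \<sigma>) \<in> F" using F(2) by force
    then have "(y, \<lambda>m. if even m then of_discrete (x (m div 2)) else \<sigma> (m div 2)) \<in> ?f -` F"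
      by (simp add: of_discrete_inverse)
    then show "y \<in> fst ` (?f -` F)" by (rule rev_image_eqI) simp
  next
    fix y assume "y \<in> fst ` (?f -` F)"
    then obtain z where "?f z \<in> F" "y = fst z" by blast
    then show "y \<in> snd ` S" using F(2) by force
  qed
  ultimately show ?thesis unfolding analytic_def by blast
qed

text \<open>Puts the point itself into the code, at the even entries. An initial segment of the code
  then fixes an initial segment of the point, as the cylinders in \<open>lusin_separation\<close>
  require.\<close>

lemma analytic_reindex:
  fixes A :: "(nat \<Rightarrow> nat discrete) set"
  assumes "analytic A"
  obtains F :: "(nat \<Rightarrow> nat) set" where "closed F" "A = (\<lambda>\<rho>. \<lambda>n. discrete (\<rho> (2 * n))) ` F"
proof -
  obtain F :: "((nat \<Rightarrow> nat discrete) \<times> (nat \<Rightarrow> nat)) set" where F: "closed F" "A = fst ` F"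
    using assms unfolding analytic_def by auto
  let ?f = "\<lambda>\<rho> :: nat \<Rightarrow> nat. (\<lambda>n. discrete (\<rho> (2 * n)), \<lambda>n. \<rho> (2 * n + 1))"
  have "continuous_on UNIV ?f"
    by (intro continuous_on_Pair continuous_on_coordinatewise_then_product
        continuous_on_compose2[OF Topological_Spaces.continuous_on_discrete[of UNIV discrete] continuous_on_product_coordinates]
        continuous_on_product_coordinates subset_UNIV)
  then have "closed (?f -` F)" using F(1) by (rule closed_vimage[rotated])
  moreover have "A = (\<lambda>\<rho>. \<lambda>n. discrete (\<rho> (2 * n))) ` (?f -` F)"
  proof (intro set_eqI iffI)
    fix x assume "x \<in> A"
    then obtain \<sigma> where "(x, \<sigma>) \<in> F" using F(2) by force
    then have "(\<lambda>m. if even m then of_discrete (x (m div 2)) else \<sigma> (m div 2)) \<in> ?f -` F"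
      by (simp add: of_discrete_inverse)
    then show "x \<in> (\<lambda>\<rho>. \<lambda>n. discrete (\<rho> (2 * n))) ` (?f -` F)"
      by (rule rev_image_eqI) (simp add: of_discrete_inverse)
  next
    fix x assume "x \<in> (\<lambda>\<rho>. \<lambda>n. discrete (\<rho> (2 * n))) ` (?f -` F)"
    then show "x \<in> A" using F(2) by force
  qed
  ultimately show ?thesis using that by blast
qed

lemma tendsto_fun_iff:
  fixes f :: "'b \<Rightarrow> 'i \<Rightarrow> 'a::topological_space"
  shows "(f \<longlongrightarrow> l) F \<longleftrightarrow> (\<forall>i. ((\<lambda>x. f x i) \<longlongrightarrow> l i) F)"
  using limitin_componentwise[of "\<lambda>_. euclidean" UNIV f l F]
  by (simp add: euclidean_product_topology)

lemma baire_tendstoI: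
  fixes f :: "nat \<Rightarrow> nat \<Rightarrow> nat"
  assumes "\<And>n i. i < n \<Longrightarrow> f n i = x i"
  shows "f \<longlonglongrightarrow> x"
  unfolding tendsto_fun_iff
proof
  fix i
  show "(\<lambda>n. f n i) \<longlonglongrightarrow> x i"
    by (rule tendsto_eventually) (use assms in \<open>auto intro: eventually_mono[OF eventually_gt_at_top[of i]]\<close>)
qed

section \<open>Separation of analytic sets by Borel sets\<close>

definition borel_separable :: "'a::topological_space set \<Rightarrow> 'a set \<Rightarrow> bool" where
  "borel_separable A B \<longleftrightarrow> (\<exists>S\<in>sets borel. A \<subseteq> S \<and> S \<inter> B = {})"

lemma borel_separable_UN:
  assumes "\<And>i j. borel_separable (A i) (B j)"
  shows "borel_separable (\<Union>i::nat. A i) (\<Union>j::nat. B j)"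
proof -
  obtain S where S: "\<And>i j. S i j \<in> sets borel" "\<And>i j. A i \<subseteq> S i j" "\<And>i j. S i j \<inter> B j = {}"
    using assms unfolding borel_separable_def by metis
  have "(\<Union>i. \<Inter>j. S i j) \<in> sets borel" using S(1) by auto
  moreover have "(\<Union>i. A i) \<subseteq> (\<Union>i. \<Inter>j. S i j)" using S(2) by blast
  moreover have "(\<Union>i. \<Inter>j. S i j) \<inter> (\<Union>j. B j) = {}" using S(3) by blast
  ultimately show ?thesis unfolding borel_separable_def by blast
qed

text \<open>By \<open>borel_separable_UN\<close>, nonseparability descends to a pair of pieces whose
  code prefixes are fixed one entry further. The limiting codes \<open>u\<close> and
  \<open>v\<close> lie in the closed sets \<open>F\<close> and \<open>G\<close>, so they name
  distinct points. A coordinate where these differ separates all sufficiently small pieces, a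
  contradiction.\<close>

lemma lusin_separation:
  fixes A B :: "(nat \<Rightarrow> nat discrete) set"
  assumes "analytic A" "analytic B" "A \<inter> B = {}"
  shows "borel_separable A B"
proof (rule ccontr)
  assume nsep: "\<not> borel_separable A B"
  define h where "h = (\<lambda>\<rho> :: nat \<Rightarrow> nat. \<lambda>n. discrete (\<rho> (2 * n)))"
  obtain F where F: "closed F" "A = h ` F"
    using analytic_reindex[OF assms(1)] unfolding h_def by metis
  obtain G where G: "closed G" "B = h ` G"
    using analytic_reindex[OF assms(2)] unfolding h_def by metis
  define cyl where "cyl = (\<lambda>(H :: (nat \<Rightarrow> nat) set) u n. h ` {\<rho> \<in> H. \<forall>i<n::nat. \<rho> i = u i})"
  have cyl_split: "cyl H u n = (\<Union>m. cyl H (u(n := m)) (Suc n))" for H u n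
  proof -
    have "{\<rho> \<in> H. \<forall>i<n. \<rho> i = u i} = (\<Union>m. {\<rho> \<in> H. \<forall>i<Suc n. \<rho> i = (u(n := m)) i})"
      by (auto simp: less_Suc_eq)
    then show ?thesis by (simp only: cyl_def image_UN)
  qed
  have "\<exists>f. \<forall>n. (case f n of (u, v) \<Rightarrow> \<not> borel_separable (cyl F u n) (cyl G v n)) \<and>
      (\<forall>i<n. fst (f (Suc n)) i = fst (f n) i \<and> snd (f (Suc n)) i = snd (f n) i)"
  proof (rule dependent_nat_choice)
    show "\<exists>x. case x of (u, v) \<Rightarrow> \<not> borel_separable (cyl F u 0) (cyl G v 0)"
      using nsep F G by (simp add: cyl_def)
  next
    fix x :: "(nat \<Rightarrow> nat) \<times> (nat \<Rightarrow> nat)" and n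
    obtain u v where x: "x = (u, v)" by force
    assume "case x of (u, v) \<Rightarrow> \<not> borel_separable (cyl F u n) (cyl G v n)"
    then have "\<not> borel_separable (\<Union>m. cyl F (u(n := m)) (Suc n)) (\<Union>m. cyl G (v(n := m)) (Suc n))"
      using cyl_split[of F u n] cyl_split[of G v n] by (simp add: x)
    then obtain i j where "\<not> borel_separable (cyl F (u(n := i)) (Suc n)) (cyl G (v(n := j)) (Suc n))"
      using borel_separable_UN by metis
    then show "\<exists>y. (case y of (u, v) \<Rightarrow> \<not> borel_separable (cyl F u (Suc n)) (cyl G v (Suc n))) \<and>
        (\<forall>i<n. fst y i = fst x i \<and> snd y i = snd x i)"
      by (intro exI[of _ "(u(n := i), v(n := j))"]) (auto simp: x)
  qed
  then obtain f where f: "\<And>n. \<not> borel_separable (cyl F (fst (f n)) n) (cyl G (snd (f n)) n)"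
    "\<And>n i. i < n \<Longrightarrow> fst (f (Suc n)) i = fst (f n) i" "\<And>n i. i < n \<Longrightarrow> snd (f (Suc n)) i = snd (f n) i"
    by (auto simp: split_beta)
  define u where "u = (\<lambda>i. fst (f (Suc i)) i)"
  define v where "v = (\<lambda>i. snd (f (Suc i)) i)"
  have fu: "fst (f n) i = u i" if "i < n" for n i
    using that by (induction n) (auto simp: u_def less_Suc_eq f(2))
  have fv: "snd (f n) i = v i" if "i < n" for n i
    using that by (induction n) (auto simp: v_def less_Suc_eq f(3))
  have nonsep: "\<not> borel_separable (cyl F u n) (cyl G v n)" for n
    using f(1)[of n] fu fv by (simp add: cyl_def)
  have lim: "w \<in> H" if "closed H" "\<And>n. cyl H w n \<noteq> {}" for H w
  proof -
    have "\<forall>n. \<exists>\<rho>. \<rho> \<in> H \<and> (\<forall>i<n. \<rho> i = w i)" using that(2) by (auto simp: cyl_def)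
    from choice[OF this] obtain \<rho> where \<rho>: "\<And>n. \<rho> n \<in> H" "\<And>n i. i < n \<Longrightarrow> \<rho> n i = w i" by blast
    show ?thesis by (rule closed_sequentially[OF that(1) \<rho>(1) baire_tendstoI[OF \<rho>(2)]])
  qed
  have "cyl F u n \<noteq> {}" for n
    using nonsep[of n] by (auto simp: borel_separable_def)
  then have "h u \<in> A" using lim F by auto
  moreover have "cyl G v n \<noteq> {}" for n
  proof
    assume "cyl G v n = {}"
    with nonsep[of n] show False by (auto simp: borel_separable_def intro: bexI[of _ UNIV])
  qed
  then have "h v \<in> B" using lim G by auto
  ultimately have "h u \<noteq> h v" using assms(3) by auto
  then obtain m where m: "h u m \<noteq> h v m" by auto
  let ?S = "{x :: nat \<Rightarrow> nat discrete. x m = h u m}"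
  have "?S = (\<lambda>x. x m) -` {h u m}" by auto
  moreover have "open ((\<lambda>x :: nat \<Rightarrow> nat discrete. x m) -` {h u m})"
    by (rule open_vimage) (auto simp: Discrete_Topology.open_discrete)
  ultimately have "?S \<in> sets borel" by auto
  \<comment> \<open>Coordinate \<open>m\<close> of \<open>h\<close> is read from entry
    \<open>2 * m\<close>, so prefixes of length \<open>Suc (2 * m)\<close> determine it.\<close>
  then have "borel_separable (cyl F u (Suc (2 * m))) (cyl G v (Suc (2 * m)))"
    using m unfolding borel_separable_def by (intro bexI[of _ ?S]) (auto simp: cyl_def h_def)
  then show False using nonsep by blast
qed

text \<open>A Borel set that separates the two saturations need not be invariant. Its saturation is
  analytic and still disjoint from that of \<open>D\<close>, so it can be separated again. The union
  of the resulting chain is invariant because saturation moves each member into the next.\<close>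

lemma borel_invariant_separation:
  fixes C D :: "(nat \<Rightarrow> nat discrete) set"
  assumes C: "C \<in> sets borel" and D: "D \<in> sets borel" and E: "E \<in> sets borel" "equiv UNIV E"
    and disj: "E \<inter> C \<times> D = {}"
  shows "\<exists>U\<in>sets borel. C \<subseteq> U \<and> U \<inter> D = {} \<and> (\<forall>(x, y)\<in>E. x \<in> U \<longleftrightarrow> y \<in> U)"
proof -
  have sat: "analytic (E `` B)" if "B \<in> sets borel" for B
  proof -
    have "B \<times> UNIV \<in> sets (borel \<Otimes>\<^sub>M borel :: ((nat \<Rightarrow> nat discrete) \<times> (nat \<Rightarrow> nat discrete)) measure)"
      using that by auto
    then have "E \<inter> (B \<times> UNIV) \<in> sets borel" using E(1) unfolding borel_prod by (rule sets.Int[rotated])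
    moreover have "E `` B = snd ` (E \<inter> (B \<times> UNIV))" by force
    ultimately show ?thesis using analytic_image_snd[OF analytic_borel[of "E \<inter> (B \<times> UNIV)"]] by simp
  qed
  have E': "(x, x) \<in> E" "(x, y) \<in> E \<Longrightarrow> (y, x) \<in> E" "(x, y) \<in> E \<Longrightarrow> (y, z) \<in> E \<Longrightarrow> (x, z) \<in> E" for x y z
    using E(2) unfolding equiv_def refl_on_def by (blast dest: symD transD)+
  \<comment> \<open>Disjointness from the saturation of \<open>D\<close>, rather than from
    \<open>D\<close>, is what survives saturating \<open>B\<close>.\<close>
  let ?P = "\<lambda>B. B \<in> sets borel \<and> B \<inter> E `` D = {}"
  have ext: "\<exists>S. ?P S \<and> E `` B \<subseteq> S" if "?P B" for B
  proof -
    have "E `` B \<inter> E `` D = {}" using that E' by blast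
    then have "borel_separable (E `` B) (E `` D)" using that D by (intro lusin_separation sat) auto
    then show ?thesis unfolding borel_separable_def by blast
  qed
  have "C \<inter> E `` D = {}"
  proof (rule ccontr)
    assume "C \<inter> E `` D \<noteq> {}"
    then obtain x y where "x \<in> C" "y \<in> D" "(y, x) \<in> E" by blast
    then show False using disj E'(2)[of y x] by blast
  qed
  with C have PC: "?P C" by simp
  have "\<exists>f. \<forall>n::nat. (?P (f n) \<and> C \<subseteq> f n) \<and> E `` f n \<subseteq> f (Suc n)"
  proof (rule dependent_nat_choice)
    show "\<exists>x. ?P x \<and> C \<subseteq> x" using PC by (intro exI[of _ C]) simp
    fix B and n :: nat assume B: "?P B \<and> C \<subseteq> B"
    then obtain S where S: "?P S" "E `` B \<subseteq> S" using ext[of B] by blast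
    have "B \<subseteq> E `` B" using E'(1) by blast
    with B S(2) have "C \<subseteq> S" by (meson subset_trans)
    then show "\<exists>S. (?P S \<and> C \<subseteq> S) \<and> E `` B \<subseteq> S" using S by (intro exI[of _ S]) simp
  qed
  then obtain f where "\<forall>n::nat. (?P (f n) \<and> C \<subseteq> f n) \<and> E `` f n \<subseteq> f (Suc n)" ..
  then have f: "f n \<in> sets borel" "f n \<inter> E `` D = {}" "C \<subseteq> f n" "E `` f n \<subseteq> f (Suc n)" for n
    by simp_all
  have "D \<subseteq> E `` D" using E'(1) by blast
  then have "(\<Union>n. f n) \<inter> D = {}" using f(2) by blast
  moreover have inv: "y \<in> (\<Union>n. f n)" if xy: "(x, y) \<in> E" and x: "x \<in> (\<Union>n. f n)" for x y
  proof -
    obtain n where "x \<in> f n" using x by blast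
    then have "y \<in> f (Suc n)" using xy f(4)[of n] by blast
    then show ?thesis by blast
  qed
  then have "\<forall>(x, y)\<in>E. x \<in> (\<Union>n. f n) \<longleftrightarrow> y \<in> (\<Union>n. f n)"
    using E'(2) by blast
  moreover have "(\<Union>n. f n) \<in> sets borel" "C \<subseteq> (\<Union>n. f n)" using f(1,3) by auto
  ultimately show ?thesis by (intro bexI[of _ "\<Union>n. f n"]) simp_all
qed

subsection \<open>Standard Borel spaces as retracts of the Baire space\<close>

text \<open>Discreteness of the coordinates allows an arbitrary \<open>P\<close>; below it is a
  metric condition on the points with these indices.\<close>

lemma open_coordinates2:
  "open {\<sigma> :: nat \<Rightarrow> nat discrete. P (\<sigma> k) (\<sigma> l)}"
proof -
  have "open ((\<lambda>\<sigma> :: nat \<Rightarrow> nat discrete. \<sigma> i) -` {a})" for i a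
    by (rule open_vimage) (auto simp: Discrete_Topology.open_discrete)
  then have "open (\<Union>(a, b)\<in>{(a, b). P a b}. (\<lambda>\<sigma>. \<sigma> k) -` {a} \<inter> (\<lambda>\<sigma>. \<sigma> l) -` {b})"
    by (intro open_UN) (auto intro: open_Int)
  also have "(\<Union>(a, b)\<in>{(a, b). P a b}. (\<lambda>\<sigma>. \<sigma> k) -` {a} \<inter> (\<lambda>\<sigma>. \<sigma> l) -` {b}) =
      {\<sigma> :: nat \<Rightarrow> nat discrete. P (\<sigma> k) (\<sigma> l)}" by auto
  finally show ?thesis .
qed

text \<open>A point is coded by the indices of the first points of a dense sequence that approximate it
  up to \<open>2\<^sup>-\<^sup>k\<close>. The decoding map extends to all sequences of indices.\<close>

lemma standard_borel_retract:
  assumes M: "standard_borel_space M" and ne: "space M \<noteq> {}"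
  obtains \<psi> :: "'a \<Rightarrow> nat \<Rightarrow> nat discrete" and \<theta> where "\<psi> \<in> measurable M borel"
    "\<theta> \<in> measurable borel M" "\<And>x. x \<in> space M \<Longrightarrow> \<theta> (\<psi> x) = x"
proof -
  obtain X where X: "completely_metrizable_space X" "separable_space X" "topspace X = space M"
    "sets M = sigma_sets (space M) {U. openin X U}"
    using M unfolding standard_borel_space_def by blast
  obtain S d where Sd: "Metric_space S d" "Metric_space.mcomplete S d" "X = Metric_space.mtopology S d"
    using X(1) unfolding completely_metrizable_space_def by blast
  interpret Metric_space S d by fact
  have S: "space M = S" using X(3) Sd(3) by simp
  obtain C where C: "countable C" "C \<subseteq> S" "mtopology closure_of C = S"
    using X(2) unfolding separable_space_def Sd(3) by auto
  have "C \<noteq> {}" using C(3) ne S by auto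
  define q where "q = from_nat_into C"
  have q_range: "range q = C" unfolding q_def using \<open>C \<noteq> {}\<close> C(1) by (rule range_from_nat_into)
  have q: "q i \<in> S" for i using q_range C(2) by auto
  have dense: "\<exists>i. d x (q i) < e" if "x \<in> S" and e: "0 < e" for x e
  proof -
    have "x \<in> mtopology closure_of C" using that(1) C(3) by simp
    then obtain y where "y \<in> C" "d x y < e" unfolding metric_closure_of using e by auto
    then show ?thesis using q_range by blast
  qed
  define \<psi> where "\<psi> = (\<lambda>x k. discrete (LEAST i. d x (q i) < (1/2) ^ k))"
  have \<psi>: "d x (q (of_discrete (\<psi> x k))) < (1/2) ^ k" if "x \<in> S" for x k
    unfolding \<psi>_def using dense[OF that, of "(1/2) ^ k"] by (simp add: discrete_inverse) (metis LeastI_ex)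
  have mball_M: "mball x r \<in> sets M" for x r
    unfolding X(4) Sd(3) by (intro sigma_sets.Basic) simp
  have "(\<lambda>x. \<psi> x k) \<in> borel_measurable M" for k
  proof -
    have "{x \<in> space M. d x (q i) < (1/2) ^ k} = mball (q i) ((1/2) ^ k)" for i
      using q by (auto simp: S commute)
    then have "Measurable.pred M (\<lambda>x. d x (q i) < (1/2) ^ k)" for i
      using mball_M by (simp add: pred_def)
    then have "(\<lambda>x. LEAST i. d x (q i) < (1/2) ^ k) \<in> measurable M (count_space UNIV)"
      by (rule measurable_Least)
    then show ?thesis unfolding \<psi>_def by (rule measurable_compose) simp
  qed
  then have \<psi>_meas: "\<psi> \<in> measurable M borel" by (rule measurable_coordinatewise_then_product)
  define s where "s = (\<lambda>(\<sigma> :: nat \<Rightarrow> nat discrete) k. q (of_discrete (\<sigma> k)))"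
  have s: "s \<sigma> k \<in> S" for \<sigma> k by (simp add: s_def q)
  \<comment> \<open>The bound is the triangle inequality through a point within
    \<open>(1/2) ^ k\<close> and \<open>(1/2) ^ l\<close> of the two terms, so every code
    \<open>\<psi> x\<close> satisfies it. Conversely, it forces a Cauchy sequence whose limit is
    within \<open>(1/2) ^ k\<close> of the \<open>k\<close>-th term.\<close>
  define Z where "Z = {\<sigma>. \<forall>k l. d (s \<sigma> k) (s \<sigma> l) \<le> (1/2) ^ k + (1/2) ^ l}"
  have lim: "\<exists>x. x \<in> S \<and> (\<forall>k. d x (s \<sigma> k) \<le> (1/2) ^ k)" if \<sigma>: "\<sigma> \<in> Z" for \<sigma>
  proof -
    have Zd: "d (s \<sigma> k) (s \<sigma> l) \<le> (1/2) ^ k + (1/2) ^ l" for k l using \<sigma> by (simp add: Z_def)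
    have small: "\<exists>N. \<forall>n\<ge>N. (1/2 :: real) ^ n < e" if e: "0 < e" for e
    proof -
      obtain N where N: "(1/2 :: real) ^ N < e" using real_arch_pow_inv[OF e, of "1/2"] by auto
      have "(1/2 :: real) ^ n \<le> (1/2) ^ N" if "N \<le> n" for n using that by (intro power_decreasing) auto
      then show ?thesis using N by (meson le_less_trans)
    qed
    have "MCauchy (s \<sigma>)" unfolding MCauchy_def
    proof (intro conjI allI impI)
      show "range (s \<sigma>) \<subseteq> S" using s by auto
      fix e :: real assume "0 < e"
      then obtain N where N: "\<And>n. n \<ge> N \<Longrightarrow> (1/2 :: real) ^ n < e / 2" using small[of "e / 2"] by auto
      have "d (s \<sigma> n) (s \<sigma> n') < e" if "N \<le> n" "N \<le> n'" for n n'
        using Zd[of n n'] N[OF that(1)] N[OF that(2)] by linarith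
      then show "\<exists>N. \<forall>n n'. N \<le> n \<longrightarrow> N \<le> n' \<longrightarrow> d (s \<sigma> n) (s \<sigma> n') < e" by blast
    qed
    then obtain x where "limitin mtopology (s \<sigma>) x sequentially"
      using Sd(2) unfolding mcomplete_def by blast
    then have x: "x \<in> S" "\<And>e. 0 < e \<Longrightarrow> \<exists>N. \<forall>n\<ge>N. d (s \<sigma> n) x < e"
      unfolding limit_metric_sequentially by blast+
    have "d x (s \<sigma> k) \<le> (1/2) ^ k" for k
    proof (rule field_le_epsilon)
      fix e :: real assume e: "0 < e"
      obtain N where N: "\<And>n. n \<ge> N \<Longrightarrow> d (s \<sigma> n) x < e / 2" using x(2)[of "e / 2"] e by auto
      obtain N' where N': "\<And>n. n \<ge> N' \<Longrightarrow> (1/2 :: real) ^ n < e / 2" using small[of "e / 2"] e by auto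
      let ?n = "max N N'"
      have "d x (s \<sigma> k) \<le> d x (s \<sigma> ?n) + d (s \<sigma> ?n) (s \<sigma> k)" using x(1) s by (intro triangle)
      then show "d x (s \<sigma> k) \<le> (1/2) ^ k + e"
        using N[of ?n] N'[of ?n] Zd[of ?n k] commute[of x "s \<sigma> ?n"] by simp
    qed
    then show ?thesis using x(1) by blast
  qed
  \<comment> \<open>On \<open>Z\<close> the point is unique, as the radii tend to \<open>0\<close>.
    Off \<open>Z\<close> the constant \<open>q 0\<close> keeps the values of \<open>\<theta>\<close>
    in the space.\<close>
  define \<theta> where "\<theta> = (\<lambda>\<sigma>. if \<sigma> \<in> Z then SOME x. x \<in> S \<and> (\<forall>k. d x (s \<sigma> k) \<le> (1/2) ^ k) else q 0)"
  have \<theta>_Z: "\<theta> \<sigma> \<in> S" "d (\<theta> \<sigma>) (s \<sigma> k) \<le> (1/2) ^ k" if "\<sigma> \<in> Z" for \<sigma> k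
    using someI_ex[OF lim[OF that]] that by (auto simp: \<theta>_def)
  have \<theta>_S: "\<theta> \<sigma> \<in> S" for \<sigma> using \<theta>_Z q by (cases "\<sigma> \<in> Z") (auto simp: \<theta>_def)
  have close: "\<exists>k. 2 * (1/2 :: real) ^ k < e" if "0 < e" for e
    using real_arch_pow_inv[of "e / 2" "1/2"] that by (auto simp: field_simps)
  have "\<theta> (\<psi> x) = x" if x: "x \<in> S" for x
  proof -
    have xs: "d x (s (\<psi> x) k) < (1/2) ^ k" for k using \<psi>[OF x] by (simp add: s_def)
    have "d (s (\<psi> x) k) (s (\<psi> x) l) \<le> (1/2) ^ k + (1/2) ^ l" for k l
      using triangle[OF s x s, of "\<psi> x" k "\<psi> x" l] xs[of k] xs[of l] commute[of x "s (\<psi> x) k"] by linarith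
    then have Z: "\<psi> x \<in> Z" by (simp add: Z_def)
    have "d (\<theta> (\<psi> x)) x \<le> 2 * (1/2) ^ k" for k
      using triangle[OF \<theta>_S s x, of "\<psi> x" "\<psi> x" k] \<theta>_Z(2)[OF Z, of k] xs[of k] commute[of x "s (\<psi> x) k"]
      by linarith
    then have "\<not> 0 < d (\<theta> (\<psi> x)) x" using close by (meson not_le)
    then have "d (\<theta> (\<psi> x)) x = 0" using nonneg[of "\<theta> (\<psi> x)" x] by linarith
    then show ?thesis using zero[OF \<theta>_S x] by simp
  qed
  moreover have "\<theta> \<in> measurable borel M"
  proof (rule measurable_sigma_sets[OF X(4)])
    show "{U. openin X U} \<subseteq> Pow (space M)" using openin_subset[of X] X(3) by auto
    show "\<theta> \<in> space borel \<rightarrow> space M" using \<theta>_S S by auto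
    fix U assume "U \<in> {U. openin X U}"
    then have U: "openin mtopology U" by (simp add: Sd(3))
    have Z_borel: "Z \<in> sets borel"
    proof -
      have "Z = (\<Inter>k. \<Inter>l. {\<sigma>. d (s \<sigma> k) (s \<sigma> l) \<le> (1/2) ^ k + (1/2) ^ l})" by (auto simp: Z_def)
      also have "\<dots> \<in> sets borel"
        unfolding s_def by (intro sets.countable_INT'' borel_open open_coordinates2) auto
      finally show ?thesis .
    qed
    \<comment> \<open>For \<open>\<sigma>\<close> in \<open>Z\<close> every closed ball here
      contains \<open>\<theta> \<sigma>\<close> and the radii shrink, so within \<open>Z\<close> the
      preimage of \<open>U\<close> is \<open>W\<close>. Each condition concerns a single coordinate,
      which makes \<open>W\<close> open.\<close>
    define W where "W = (\<Union>k. {\<sigma>. mcball (s \<sigma> k) ((1/2) ^ k) \<subseteq> U})"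
    have "open W" unfolding W_def s_def by (intro open_UN ballI open_coordinates2)
    have iff: "\<theta> \<sigma> \<in> U \<longleftrightarrow> \<sigma> \<in> W" if \<sigma>: "\<sigma> \<in> Z" for \<sigma>
    proof
      assume "\<theta> \<sigma> \<in> U"
      then obtain r where r: "0 < r" "mball (\<theta> \<sigma>) r \<subseteq> U" using U unfolding openin_mtopology by blast
      obtain k where k: "2 * (1/2 :: real) ^ k < r" using close[OF r(1)] ..
      have "mcball (s \<sigma> k) ((1/2) ^ k) \<subseteq> mball (\<theta> \<sigma>) r"
      proof
        fix y assume y: "y \<in> mcball (s \<sigma> k) ((1/2) ^ k)"
        then have "d (\<theta> \<sigma>) y \<le> d (\<theta> \<sigma>) (s \<sigma> k) + d (s \<sigma> k) y" by (intro triangle \<theta>_S) auto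
        then show "y \<in> mball (\<theta> \<sigma>) r" using y k \<theta>_Z(2)[OF \<sigma>, of k] \<theta>_S by simp
      qed
      then show "\<sigma> \<in> W" using r(2) unfolding W_def by blast
    next
      assume "\<sigma> \<in> W"
      then obtain k where k: "mcball (s \<sigma> k) ((1/2) ^ k) \<subseteq> U" unfolding W_def by blast
      have "\<theta> \<sigma> \<in> mcball (s \<sigma> k) ((1/2) ^ k)"
        using \<theta>_Z(2)[OF \<sigma>, of k] \<theta>_S s commute by simp
      then show "\<theta> \<sigma> \<in> U" using k by blast
    qed
    have "\<theta> -` U = (Z \<inter> W) \<union> (if q 0 \<in> U then - Z else {})"
    proof (rule set_eqI)
      fix \<sigma>
      show "\<sigma> \<in> \<theta> -` U \<longleftrightarrow> \<sigma> \<in> (Z \<inter> W) \<union> (if q 0 \<in> U then - Z else {})"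
        using iff[of \<sigma>] by (cases "\<sigma> \<in> Z") (auto simp: \<theta>_def)
    qed
    also have "\<dots> \<in> sets borel" using Z_borel \<open>open W\<close> by auto
    finally show "\<theta> -` U \<inter> space borel \<in> sets borel" by simp
  qed
  ultimately show ?thesis using that \<psi>_meas S by blast
qed

subsection \<open>Duality for couplings on a Polish space\<close>

lemma (in finite_measure) measure_Un_Int:
  assumes "A \<in> sets M" "B \<in> sets M"
  shows "measure M (A \<union> B) + measure M (A \<inter> B) = measure M A + measure M B"
  using finite_measure_Union'[OF assms] finite_measure_Diff'[OF assms(2,1)] by (simp add: Int_commute)

lemma open_eq_UN_rectangles:
  fixes G :: "('a::second_countable_topology \<times> 'a) set"
  assumes "open G"
  shows "\<exists>U V. (\<forall>i::nat. open (U i) \<and> open (V i)) \<and> G = (\<Union>i. U i \<times> V i)"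
proof -
  obtain \<B> :: "'a set set" where \<B>: "countable \<B>" "topological_basis \<B>"
    using ex_countable_basis by auto
  \<comment> \<open>The empty rectangle makes the family nonempty, so that
    \<open>from_nat_into\<close> enumerates it even if no basic rectangle lies in
    \<open>G\<close>.\<close>
  define \<R> where "\<R> = insert ({}, {}) {(U, V). U \<in> \<B> \<and> V \<in> \<B> \<and> U \<times> V \<subseteq> G}"
  have "countable \<R>" unfolding \<R>_def
    by (intro countable_insert countable_subset[OF _ countable_SIGMA[OF \<B>(1) \<B>(1)]]) auto
  define R where "R = from_nat_into \<R>"
  have R: "range R = \<R>"
    unfolding R_def using \<open>countable \<R>\<close> by (rule range_from_nat_into[rotated]) (simp add: \<R>_def)
  have RG: "fst (R i) \<times> snd (R i) \<subseteq> G" "open (fst (R i))" "open (snd (R i))" for i :: nat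
  proof -
    have "R i \<in> \<R>" using R by auto
    then show "fst (R i) \<times> snd (R i) \<subseteq> G" "open (fst (R i))" "open (snd (R i))"
      using \<B>(2) by (auto simp: \<R>_def topological_basis_open)
  qed
  have G: "G = (\<Union>i. fst (R i) \<times> snd (R i))"
  proof
    show "G \<subseteq> (\<Union>i. fst (R i) \<times> snd (R i))"
    proof
      fix z assume "z \<in> G"
      with assms obtain A B where AB: "open A" "open B" "z \<in> A \<times> B" "A \<times> B \<subseteq> G"
        by (rule open_prod_elim)
      have "fst z \<in> A" "snd z \<in> B" using AB(3) by auto
      obtain U where "U \<in> \<B>" "fst z \<in> U" "U \<subseteq> A"
        using topological_basisE[OF \<B>(2) AB(1) \<open>fst z \<in> A\<close>] by blast
      moreover obtain V where "V \<in> \<B>" "snd z \<in> V" "V \<subseteq> B"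
        using topological_basisE[OF \<B>(2) AB(2) \<open>snd z \<in> B\<close>] by blast
      ultimately have "(U, V) \<in> \<R>" "z \<in> U \<times> V" using AB(4) by (auto simp: \<R>_def mem_Times_iff)
      moreover from this(1) obtain i where "R i = (U, V)" unfolding R[symmetric] by auto
      ultimately show "z \<in> (\<Union>i. fst (R i) \<times> snd (R i))" by (intro UN_I[of i]) auto
    qed
  qed (use RG(1) in blast)
  then show ?thesis using RG(2,3) by (intro exI[of _ "\<lambda>i. fst (R i)"] exI[of _ "\<lambda>i. snd (R i)"]) simp
qed

lemma inner_regular_compact:
  fixes M :: "'a::polish_space measure"
  assumes "prob_space M" "sets M = sets borel" "B \<in> sets borel" "0 < \<epsilon>"
  shows "\<exists>K. compact K \<and> K \<subseteq> B \<and> measure M B < measure M K + \<epsilon>"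
proof (rule ccontr)
  interpret prob_space M by fact
  assume neg: "\<not> ?thesis"
  have "emeasure M B = (SUP K \<in> {K. K \<subseteq> B \<and> compact K}. emeasure M K)"
    using assms by (intro inner_regular) auto
  also have "\<dots> \<le> ennreal (measure M B - \<epsilon>)"
  proof (rule SUP_least)
    fix K assume "K \<in> {K. K \<subseteq> B \<and> compact K}"
    then have "\<not> measure M B < measure M K + \<epsilon>" using neg by blast
    then have "measure M K \<le> measure M B - \<epsilon>" by linarith
    then show "emeasure M K \<le> ennreal (measure M B - \<epsilon>)"
      by (simp add: emeasure_eq_measure ennreal_leI)
  qed
  finally have le: "emeasure M B \<le> ennreal (measure M B - \<epsilon>)" .
  \<comment> \<open>\<open>ennreal\<close> truncates negative numbers, so \<open>le\<close> yields a
    real inequality only once \<open>measure M B - \<epsilon>\<close> is nonnegative; the compact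
    set \<open>{}\<close> shows that.\<close>
  from neg have "\<not> (compact ({} :: 'a set) \<and> {} \<subseteq> B \<and> measure M B < measure M {} + \<epsilon>)" by (rule contrapos_nn) (rule exI[of _ "{}"])
  then have "0 \<le> measure M B - \<epsilon>" by simp
  with le have "measure M B \<le> measure M B - \<epsilon>"
    by (simp add: emeasure_eq_measure ennreal_le_iff)
  then show False using assms(4) by simp
qed

lemma outer_regular_open:
  fixes M :: "'a::polish_space measure"
  assumes "prob_space M" "sets M = sets borel" "B \<in> sets borel" "0 < \<epsilon>"
  shows "\<exists>U. open U \<and> B \<subseteq> U \<and> measure M U < measure M B + \<epsilon>"
proof (rule ccontr)
  interpret prob_space M by fact
  assume neg: "\<not> ?thesis"
  have "ennreal (measure M B + \<epsilon>) \<le> (INF U \<in> {U. B \<subseteq> U \<and> open U}. emeasure M U)"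
  proof (rule INF_greatest)
    fix U assume "U \<in> {U. B \<subseteq> U \<and> open U}"
    then have "\<not> measure M U < measure M B + \<epsilon>" using neg by blast
    then have "measure M B + \<epsilon> \<le> measure M U" by linarith
    then show "ennreal (measure M B + \<epsilon>) \<le> emeasure M U"
      by (simp add: emeasure_eq_measure ennreal_leI)
  qed
  also have "\<dots> = emeasure M B"
    using assms by (intro outer_regular[symmetric]) auto
  finally have "measure M B + \<epsilon> \<le> measure M B"
    unfolding emeasure_eq_measure by (simp add: ennreal_le_iff)
  then show False using assms(4) by simp
qed

section \<open>Covers, their cost and the resulting capacity\<close>

locale borel_prob_pair =
  fixes \<mu> \<nu> :: "'a::polish_space measure"
  assumes prob: "prob_space \<mu>" "prob_space \<nu>"
    and sets_eq [measurable_cong]: "sets \<mu> = sets borel" "sets \<nu> = sets borel"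
begin

sublocale left: prob_space \<mu> by (fact prob)
sublocale right: prob_space \<nu> by (fact prob)

lemma space_eq [simp]: "space \<mu> = UNIV" "space \<nu> = UNIV"
  using sets_eq[THEN sets_eq_imp_space_eq] by auto

definition covers :: "('a \<times> 'a) set \<Rightarrow> ('a set \<times> 'a set) set" where
  "covers A = {(C, D). C \<in> sets borel \<and> D \<in> sets borel \<and> A \<subseteq> C \<times> UNIV \<union> UNIV \<times> D}"

definition cost :: "'a set \<times> 'a set \<Rightarrow> real" where
  "cost = (\<lambda>(C, D). measure \<mu> C + measure \<nu> D)"

text \<open>The dual value for maximising \<open>P A\<close> over the couplings, with potentials
  \<open>f x + g y\<close> above the indicator of \<open>A\<close> restricted to indicator functions
  \<open>f\<close> and \<open>g\<close>.\<close>

definition capacity :: "('a \<times> 'a) set \<Rightarrow> real" where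
  "capacity A = Inf (cost ` covers A)"

lemma cost_nonneg: "0 \<le> cost X"
  by (auto simp: cost_def split: prod.split)

lemma covers_UNIV: "(UNIV, UNIV) \<in> covers A"
  by (auto simp: covers_def)

lemma capacity_le: "X \<in> covers A \<Longrightarrow> capacity A \<le> cost X"
  unfolding capacity_def by (intro cInf_lower bdd_belowI[of _ 0]) (auto simp: cost_nonneg)

lemma le_capacity: "(\<And>X. X \<in> covers A \<Longrightarrow> r \<le> cost X) \<Longrightarrow> r \<le> capacity A"
  unfolding capacity_def using covers_UNIV by (intro cInf_greatest) auto

lemma capacity_less: "capacity A < r \<Longrightarrow> \<exists>X\<in>covers A. cost X < r"
  unfolding capacity_def using covers_UNIV[of A] cInf_lessD[of "cost ` covers A" r] by blast

lemma capacity_mono: "A \<subseteq> B \<Longrightarrow> capacity A \<le> capacity B"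
  by (rule le_capacity, rule capacity_le) (auto simp: covers_def)

text \<open>If \<open>(C, D)\<close> covers \<open>A\<close> and \<open>(C', D')\<close> covers a superset of \<open>A\<close>, then both \<open>(C \<inter> C', D \<union> D')\<close>
  and \<open>(C \<union> C', D \<inter> D')\<close> cover \<open>A\<close>, and the total cost is unchanged. So near-optimal covers of an
  increasing sequence can be merged almost for free.\<close>

lemma capacity_Union_less:
  assumes "incseq A" "r < capacity (\<Union>n. A n)"
  shows "\<exists>n. r < capacity (A n)"
proof (rule ccontr)
  assume "\<not> (\<exists>n. r < capacity (A n))"
  then have le: "capacity (A n) \<le> r" for n by (simp add: not_less)
  define \<epsilon> where "\<epsilon> = (capacity (\<Union>n. A n) - r) / 2"
  have \<epsilon>: "0 < \<epsilon>" "r + \<epsilon> < capacity (\<Union>n. A n)" using assms(2) by (auto simp: \<epsilon>_def field_simps)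
  \<comment> \<open>The errors from stage \<open>N\<close> onwards sum to
    \<open>\<epsilon> * (1/2) ^ N\<close>, the excess allowed in \<open>fin\<close>.\<close>
  have "\<exists>X\<in>covers (A n). cost X < capacity (A n) + \<epsilon> * (1/2) ^ Suc n" for n
    using \<epsilon> by (intro capacity_less) auto
  then obtain X where X: "\<And>n. X n \<in> covers (A n)" "\<And>n. cost (X n) < capacity (A n) + \<epsilon> * (1/2) ^ Suc n"
    by metis
  define C where "C = (\<lambda>n. fst (X n))"
  define D where "D = (\<lambda>n. snd (X n))"
  have CD[measurable]: "C n \<in> sets borel" "D n \<in> sets borel" for n
    using X(1)[of n] by (auto simp: covers_def C_def D_def)
  have cov: "A n \<subseteq> C n \<times> UNIV \<union> UNIV \<times> D n" for n
    using X(1)[of n] by (auto simp: covers_def C_def D_def)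
  have cost_CD: "measure \<mu> (C n) + measure \<nu> (D n) < capacity (A n) + \<epsilon> * (1/2) ^ Suc n" for n
    using X(2)[of n] by (simp add: cost_def C_def D_def split_beta)
  have fin: "measure \<mu> (\<Inter>n\<in>{N..m}. C n) + measure \<nu> (\<Union>n\<in>{N..m}. D n) \<le> r + \<epsilon> * (1/2) ^ N"
    if "N \<le> m" for N m
    using that
  proof (induction N rule: inc_induct)
    case base
    have "\<epsilon> * (1/2) ^ Suc m \<le> \<epsilon> * (1/2) ^ m" using \<epsilon> by simp
    then show ?case using cost_CD[of m] le[of m] by simp
  next
    case (step N)
    let ?C = "\<Inter>n\<in>{Suc N..m}. C n" and ?D = "\<Union>n\<in>{Suc N..m}. D n"
    have ins: "{N..m} = insert N {Suc N..m}" using step by auto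
    have "A N \<subseteq> C n \<times> UNIV \<union> UNIV \<times> D n" if "n \<ge> N" for n
      using incseqD[OF assms(1) that] cov[of n] by (rule subset_trans)
    then have *: "x \<in> C n \<or> y \<in> D n" if "(x, y) \<in> A N" "n \<ge> N" for x y n
      using that by blast
    have "y \<in> D N \<inter> ?D" if xy: "(x, y) \<in> A N" and x: "x \<notin> C N \<union> ?C" for x y
    proof -
      obtain n where "n \<in> {Suc N..m}" "x \<notin> C n" using x by blast
      then show ?thesis using *[OF xy, of n] *[OF xy, of N] x by auto
    qed
    then have "A N \<subseteq> (C N \<union> ?C) \<times> UNIV \<union> UNIV \<times> (D N \<inter> ?D)"
      by (intro subrelI) blast
    moreover have CD': "?C \<in> sets borel" "?D \<in> sets borel"
      by (auto intro!: sets.countable_INT'')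
    \<comment> \<open>This pair costs at least \<open>capacity (A N)\<close>. Modularity turns that
      into an upper bound for \<open>(C N \<inter> ?C, D N \<union> ?D)\<close>, in which the two
      occurrences of \<open>capacity (A N)\<close> cancel and only the errors accumulate.\<close>
    ultimately have "(C N \<union> ?C, D N \<inter> ?D) \<in> covers (A N)"
      by (simp add: covers_def)
    from capacity_le[OF this]
    have "capacity (A N) \<le> measure \<mu> (C N \<union> ?C) + measure \<nu> (D N \<inter> ?D)" by (simp add: cost_def)
    moreover have "measure \<mu> (C N \<union> ?C) + measure \<mu> (C N \<inter> ?C) = measure \<mu> (C N) + measure \<mu> ?C"
      by (intro left.measure_Un_Int) (use CD CD' in \<open>auto simp: sets_eq\<close>)
    moreover have "measure \<nu> (D N \<union> ?D) + measure \<nu> (D N \<inter> ?D) = measure \<nu> (D N) + measure \<nu> ?D"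
      by (intro right.measure_Un_Int) (use CD CD' in \<open>auto simp: sets_eq\<close>)
    moreover have "\<epsilon> * (1/2) ^ Suc N + \<epsilon> * (1/2) ^ Suc N = \<epsilon> * (1/2) ^ N" by simp
    ultimately show ?case unfolding ins using cost_CD[of N] step.IH by simp
  qed
  \<comment> \<open>\<open>CI\<close> increases to the lower limit of \<open>C\<close>, and
    \<open>DU\<close> decreases to the upper limit of \<open>D\<close>. A point of the union lies in
    almost all \<open>A k\<close>; if its second coordinate is in only finitely many
    \<open>D k\<close>, its first is in almost all \<open>C k\<close>. So the two limits cover the
    union.\<close>
  define CI where "CI = (\<lambda>N. \<Inter>n\<in>{N..}. C n)"
  define DU where "DU = (\<lambda>N. \<Union>n\<in>{N..}. D n)"
  have [measurable]: "CI n \<in> sets borel" "DU n \<in> sets borel" for n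
    by (auto simp: CI_def DU_def)
  have tail: "measure \<mu> (CI N) + measure \<nu> (DU N) \<le> r + \<epsilon> * (1/2) ^ N" for N
  proof (rule LIMSEQ_le_const2)
    have 1: "(\<lambda>k. measure \<mu> (\<Inter>n\<in>{N..N+k}. C n)) \<longlonglongrightarrow> measure \<mu> (\<Inter>k. \<Inter>n\<in>{N..N+k}. C n)"
      by (rule left.finite_Lim_measure_decseq) (auto simp: decseq_def)
    have 2: "(\<lambda>k. measure \<nu> (\<Union>n\<in>{N..N+k}. D n)) \<longlonglongrightarrow> measure \<nu> (\<Union>k. \<Union>n\<in>{N..N+k}. D n)"
      by (rule right.finite_Lim_measure_incseq) (simp add: sets_eq image_subset_iff, intro monoI UN_mono, auto)
    have UN: "(\<Union>k. {N..N+k}) = {N..}"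
    proof (intro set_eqI iffI)
      fix x assume "x \<in> {N..}"
      then show "x \<in> (\<Union>k. {N..N+k})" by (auto intro!: exI[of _ "x - N"])
    qed auto
    have "(\<Inter>k. \<Inter>n\<in>{N..N+k}. C n) = \<Inter> (C ` (\<Union>k. {N..N+k}))" by blast
    then have 3: "(\<Inter>k. \<Inter>n\<in>{N..N+k}. C n) = CI N" unfolding UN by (simp add: CI_def)
    have "(\<Union>k. \<Union>n\<in>{N..N+k}. D n) = \<Union> (D ` (\<Union>k. {N..N+k}))" by blast
    then have 4: "(\<Union>k. \<Union>n\<in>{N..N+k}. D n) = DU N" unfolding UN by (simp add: DU_def)
    show "(\<lambda>k. measure \<mu> (\<Inter>n\<in>{N..N+k}. C n) + measure \<nu> (\<Union>n\<in>{N..N+k}. D n))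
      \<longlonglongrightarrow> measure \<mu> (CI N) + measure \<nu> (DU N)"
      using tendsto_add[OF 1 2] unfolding 3 4 .
  qed (auto intro!: fin)
  have "measure \<mu> (\<Union>N. CI N) + measure \<nu> (\<Inter>N. DU N) \<le> r + \<epsilon>"
  proof (rule LIMSEQ_le_const2)
    have "(\<lambda>N. measure \<mu> (CI N)) \<longlonglongrightarrow> measure \<mu> (\<Union>N. CI N)"
      by (rule left.finite_Lim_measure_incseq) (auto simp: incseq_def CI_def)
    moreover have "(\<lambda>N. measure \<nu> (DU N)) \<longlonglongrightarrow> measure \<nu> (\<Inter>N. DU N)"
      by (rule right.finite_Lim_measure_decseq)
        (simp add: sets_eq image_subset_iff, unfold DU_def, intro antimonoI UN_mono, auto)
    ultimately show "(\<lambda>N. measure \<mu> (CI N) + measure \<nu> (DU N)) \<longlonglongrightarrow>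
        measure \<mu> (\<Union>N. CI N) + measure \<nu> (\<Inter>N. DU N)"
      by (rule tendsto_add)
    have "r + \<epsilon> * (1/2) ^ N \<le> r + \<epsilon>" for N using \<epsilon> by (simp add: power_le_one)
    then show "\<exists>N. \<forall>n\<ge>N. measure \<mu> (CI n) + measure \<nu> (DU n) \<le> r + \<epsilon>"
      using tail order_trans by blast
  qed
  moreover have "(\<Union>N. CI N, \<Inter>N. DU N) \<in> covers (\<Union>n. A n)"
  proof -
    have "x \<in> (\<Union>N. CI N) \<or> y \<in> (\<Inter>N. DU N)" if "(x, y) \<in> A n" for x y n
    proof (rule disjCI)
      assume "y \<notin> (\<Inter>N. DU N)"
      then obtain N where "\<And>k. k \<ge> N \<Longrightarrow> y \<notin> D k" by (auto simp: DU_def)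
      moreover have "(x, y) \<in> A k" if "k \<ge> n" for k
        using assms(1) that \<open>(x, y) \<in> A n\<close> by (auto simp: incseq_def)
      ultimately have "x \<in> C k" if "k \<ge> max n N" for k using cov[of k] that by auto
      then show "x \<in> (\<Union>N. CI N)" by (auto simp: CI_def intro!: exI[of _ "max n N"])
    qed
    then have "A n \<subseteq> (\<Union>N. CI N) \<times> UNIV \<union> UNIV \<times> (\<Inter>N. DU N)" for n
      by (intro subrelI) blast
    then show ?thesis by (simp add: covers_def UN_subset_iff)
  qed
  ultimately show False using capacity_le \<epsilon>(2) by (fastforce simp: cost_def)
qed

section \<open>Finitely additive couplings and their limits\<close>

text \<open>Each clause constrains finitely many values of \<open>\<pi>\<close> at a time and hence
  survives pointwise limits, which countable additivity would not.\<close>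

definition additive_coupling :: "(('a \<times> 'a) set \<Rightarrow> real) \<Rightarrow> bool" where
  "additive_coupling \<pi> \<longleftrightarrow>
     (\<forall>S\<in>sets borel. 0 \<le> \<pi> S) \<and>
     (\<forall>S\<in>sets borel. \<forall>T\<in>sets borel. S \<inter> T = {} \<longrightarrow> \<pi> (S \<union> T) = \<pi> S + \<pi> T) \<and>
     (\<forall>A\<in>sets borel. \<pi> (A \<times> UNIV) = measure \<mu> A \<and> \<pi> (UNIV \<times> A) = measure \<nu> A)"

lemma rectangle_borel [measurable]:
  "A \<in> sets borel \<Longrightarrow> B \<in> sets borel \<Longrightarrow> A \<times> B \<in> sets (borel :: ('a \<times> 'a) measure)"
  unfolding borel_prod[symmetric] by (rule pair_measureI)

text \<open>The vertices are the atoms generated by the \<open>A i\<close> and by the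
  \<open>B i\<close>, weighted by \<mu> and \<nu>. The mass that \<open>bipartite_duality\<close>
  gives to a pair of atoms is spread over their rectangle in proportion to the product measure, and
  the vertex cover becomes a cover by unions of atoms.\<close>

lemma finite_rectangles_coupling:
  assumes [measurable]: "\<And>i. A i \<in> sets borel" "\<And>i. B i \<in> sets borel"
  shows "\<exists>\<pi>. additive_coupling \<pi> \<and> capacity (\<Union>i<n::nat. A i \<times> B i) \<le> \<pi> (\<Union>i<n. A i \<times> B i)"
proof -
  define K where "K = (\<Union>i<n. A i \<times> B i)"
  define I where "I = Pow {..<n}"
  have finI: "finite I" by (simp add: I_def)
  define \<alpha> where "\<alpha> = (\<lambda>S. {x. {i\<in>{..<n}. x \<in> A i} = S})"
  define \<beta> where "\<beta> = (\<lambda>S. {x. {i\<in>{..<n}. x \<in> B i} = S})"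
  have atoms: "{x. {i\<in>{..<n}. x \<in> F i} = S} \<in> sets borel"
    if "\<And>i. F i \<in> sets borel" "S \<in> I" for F :: "nat \<Rightarrow> 'a set" and S
  proof -
    have "{x. {i\<in>{..<n}. x \<in> F i} = S} = (\<Inter>i\<in>{..<n}. if i \<in> S then F i else - F i) \<inter> UNIV"
      using that(2) by (auto simp: I_def split: if_splits)
    also have "\<dots> \<in> sets borel"
    proof (cases "n = 0")
      case False
      then have "(\<Inter>i\<in>{..<n}. if i \<in> S then F i else - F i) \<in> sets borel"
        using that(1) by (intro sets.finite_INT) auto
      then show ?thesis by simp
    qed simp
    finally show ?thesis .
  qed
  have \<alpha>_borel: "\<alpha> S \<in> sets borel" and \<beta>_borel: "\<beta> S \<in> sets borel" if "S \<in> I" for S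
    unfolding \<alpha>_def \<beta>_def using that by (rule atoms[OF assms(1)], rule atoms[OF assms(2)])
  have \<alpha>_disj: "disjoint_family_on \<alpha> I" and \<beta>_disj: "disjoint_family_on \<beta> I"
    by (auto simp: disjoint_family_on_def \<alpha>_def \<beta>_def)
  have \<alpha>_UN: "(\<Union>S\<in>I. \<alpha> S) = UNIV" and \<beta>_UN: "(\<Union>S\<in>I. \<beta> S) = UNIV"
    by (auto simp: \<alpha>_def \<beta>_def I_def)
  have sum\<alpha>: "(\<Sum>S\<in>J. measure \<mu> (Z \<inter> \<alpha> S)) = measure \<mu> (Z \<inter> (\<Union>S\<in>J. \<alpha> S))"
    if "J \<subseteq> I" "Z \<in> sets borel" for J Z
  proof -
    have "disjoint_family_on (\<lambda>S. Z \<inter> \<alpha> S) J"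
      using disjoint_family_on_mono[OF that(1) \<alpha>_disj] unfolding disjoint_family_on_def by blast
    moreover have "finite J" using that(1) finI by (rule finite_subset)
    moreover have "(\<lambda>S. Z \<inter> \<alpha> S) ` J \<subseteq> sets \<mu>"
      using that \<alpha>_borel by (auto simp: sets_eq)
    ultimately show ?thesis
      unfolding Int_UN_distrib by (intro left.finite_measure_finite_Union[symmetric])
  qed
  have sum\<beta>: "(\<Sum>S\<in>J. measure \<nu> (Z \<inter> \<beta> S)) = measure \<nu> (Z \<inter> (\<Union>S\<in>J. \<beta> S))"
    if "J \<subseteq> I" "Z \<in> sets borel" for J Z
  proof -
    have "disjoint_family_on (\<lambda>S. Z \<inter> \<beta> S) J"
      using disjoint_family_on_mono[OF that(1) \<beta>_disj] unfolding disjoint_family_on_def by blast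
    moreover have "finite J" using that(1) finI by (rule finite_subset)
    moreover have "(\<lambda>S. Z \<inter> \<beta> S) ` J \<subseteq> sets \<nu>"
      using that \<beta>_borel by (auto simp: sets_eq)
    ultimately show ?thesis
      unfolding Int_UN_distrib by (intro right.finite_measure_finite_Union[symmetric])
  qed
  define a where "a = (\<lambda>S. measure \<mu> (\<alpha> S))"
  define b where "b = (\<lambda>S. measure \<nu> (\<beta> S))"
  have ab: "sum a I = sum b I"
    using sum\<alpha>[of I UNIV] sum\<beta>[of I UNIV] left.prob_space right.prob_space
    by (simp add: a_def b_def \<alpha>_UN \<beta>_UN)
  \<comment> \<open>An atom is named by the indices of the sets that contain it. A rectangle of
    atoms is contained in \<open>K\<close> if there is a common index and is disjoint from
    \<open>K\<close> otherwise.\<close>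
  define Q where "Q = {(S, T). S \<in> I \<and> T \<in> I \<and> S \<inter> T \<noteq> {}}"
  have Q: "Q \<subseteq> I \<times> I" by (auto simp: Q_def)
  have K_eq: "K = (\<Union>(S, T)\<in>Q. \<alpha> S \<times> \<beta> T)"
  proof (intro set_eqI iffI)
    fix z assume "z \<in> K"
    then obtain i where "i < n" "fst z \<in> A i" "snd z \<in> B i" by (auto simp: K_def)
    then show "z \<in> (\<Union>(S, T)\<in>Q. \<alpha> S \<times> \<beta> T)"
      by (intro UN_I[of "({i\<in>{..<n}. fst z \<in> A i}, {i\<in>{..<n}. snd z \<in> B i})"])
        (auto simp: Q_def \<alpha>_def \<beta>_def I_def mem_Times_iff)
  next
    fix z assume "z \<in> (\<Union>(S, T)\<in>Q. \<alpha> S \<times> \<beta> T)"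
    then show "z \<in> K" by (auto simp: Q_def \<alpha>_def \<beta>_def I_def K_def)
  qed
  obtain p C D where p: "\<And>i j. i \<in> I \<Longrightarrow> j \<in> I \<Longrightarrow> 0 \<le> p i j"
    "\<And>i. i \<in> I \<Longrightarrow> (\<Sum>j\<in>I. p i j) = a i" "\<And>j. j \<in> I \<Longrightarrow> (\<Sum>i\<in>I. p i j) = b j"
    and CD: "C \<subseteq> I" "D \<subseteq> I" "Q \<subseteq> C \<times> UNIV \<union> UNIV \<times> D"
    "sum a C + sum b D \<le> (\<Sum>(i, j)\<in>Q. p i j)"
    by (rule bipartite_duality[OF finI finI Q _ _ ab]) (auto simp: a_def b_def)
  have p_le: "p S T \<le> a S" "p S T \<le> b T" if "S \<in> I" "T \<in> I" for S T
    using member_le_sum[of T I "p S"] member_le_sum[of S I "\<lambda>S. p S T"] p that finI by auto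
  \<comment> \<open>On each rectangle of atoms this is the normalised product measure times
    \<open>p S T\<close>. For null atoms the quotient is \<open>0\<close>, and no mass is lost since
    \<open>p_le\<close> makes \<open>p S T\<close> vanish there.\<close>
  define \<pi> where "\<pi> = (\<lambda>Z. \<Sum>(S, T)\<in>I \<times> I. p S T / (a S * b T) *
    measure (\<mu> \<Otimes>\<^sub>M \<nu>) (Z \<inter> (\<alpha> S \<times> \<beta> T)))"
  interpret pair_prob_space \<mu> \<nu> ..
  have prod_eq: "measure (\<mu> \<Otimes>\<^sub>M \<nu>) (X \<times> Y) = measure \<mu> X * measure \<nu> Y"
    if "X \<in> sets borel" "Y \<in> sets borel" for X Y
    using that by (simp add: right.emeasure_pair_measure_Times measure_def enn2real_mult sets_eq)
  have \<pi>_rect: "\<pi> (X \<times> Y) = (\<Sum>S\<in>I. \<Sum>T\<in>I. p S T * (measure \<mu> (X \<inter> \<alpha> S) / a S) * (measure \<nu> (Y \<inter> \<beta> T) / b T))"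
    if "X \<in> sets borel" "Y \<in> sets borel" for X Y
    unfolding \<pi>_def sum.cartesian_product
    using that \<alpha>_borel \<beta>_borel by (intro sum.cong) (auto simp: Times_Int_Times prod_eq)
  have marg1: "\<pi> (X \<times> UNIV) = measure \<mu> X" if "X \<in> sets borel" for X
  proof -
    have *: "p S T * (measure \<mu> (X \<inter> \<alpha> S) / a S) * (measure \<nu> (UNIV \<inter> \<beta> T) / b T) =
        p S T * (measure \<mu> (X \<inter> \<alpha> S) / a S)" if "S \<in> I" "T \<in> I" for S T
      using p_le(2)[OF that] p(1)[OF that] by (cases "b T = 0") (auto simp: b_def)
    have **: "a S * (measure \<mu> (X \<inter> \<alpha> S) / a S) = measure \<mu> (X \<inter> \<alpha> S)" if "S \<in> I" for S
    proof (cases "a S = 0")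
      case True
      have "measure \<mu> (X \<inter> \<alpha> S) \<le> a S" unfolding a_def
        using that \<alpha>_borel by (intro left.finite_measure_mono) (auto simp: sets_eq)
      with True have "measure \<mu> (X \<inter> \<alpha> S) = 0" using measure_nonneg[of \<mu> "X \<inter> \<alpha> S"] by linarith
      then show ?thesis by simp
    qed simp
    have "\<pi> (X \<times> UNIV) = (\<Sum>S\<in>I. \<Sum>T\<in>I. p S T * (measure \<mu> (X \<inter> \<alpha> S) / a S) *
        (measure \<nu> (UNIV \<inter> \<beta> T) / b T))"
      using that by (intro \<pi>_rect) auto
    also have "\<dots> = (\<Sum>S\<in>I. \<Sum>T\<in>I. p S T * (measure \<mu> (X \<inter> \<alpha> S) / a S))"
      by (intro sum.cong refl *)
    also have "\<dots> = (\<Sum>S\<in>I. a S * (measure \<mu> (X \<inter> \<alpha> S) / a S))"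
      by (intro sum.cong refl) (simp only: sum_distrib_right[symmetric] p(2))
    also have "\<dots> = (\<Sum>S\<in>I. measure \<mu> (X \<inter> \<alpha> S))"
      by (intro sum.cong refl **)
    finally show ?thesis using sum\<alpha>[of I X] that \<alpha>_UN by simp
  qed
  have marg2: "\<pi> (UNIV \<times> X) = measure \<nu> X" if "X \<in> sets borel" for X
  proof -
    have *: "p S T * (measure \<mu> (UNIV \<inter> \<alpha> S) / a S) * (measure \<nu> (X \<inter> \<beta> T) / b T) =
        p S T * (measure \<nu> (X \<inter> \<beta> T) / b T)" if "S \<in> I" "T \<in> I" for S T
      using p_le(1)[OF that] p(1)[OF that] by (cases "a S = 0") (auto simp: a_def)
    have **: "b S * (measure \<nu> (X \<inter> \<beta> S) / b S) = measure \<nu> (X \<inter> \<beta> S)" if "S \<in> I" for S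
    proof (cases "b S = 0")
      case True
      have "measure \<nu> (X \<inter> \<beta> S) \<le> b S" unfolding b_def
        using that \<beta>_borel by (intro right.finite_measure_mono) (auto simp: sets_eq)
      with True have "measure \<nu> (X \<inter> \<beta> S) = 0" using measure_nonneg[of \<nu> "X \<inter> \<beta> S"] by linarith
      then show ?thesis by simp
    qed simp
    have "\<pi> (UNIV \<times> X) = (\<Sum>S\<in>I. \<Sum>T\<in>I. p S T * (measure \<mu> (UNIV \<inter> \<alpha> S) / a S) *
        (measure \<nu> (X \<inter> \<beta> T) / b T))"
      using that by (intro \<pi>_rect) auto
    also have "\<dots> = (\<Sum>S\<in>I. \<Sum>T\<in>I. p S T * (measure \<nu> (X \<inter> \<beta> T) / b T))"
      by (intro sum.cong refl *)
    also have "\<dots> = (\<Sum>T\<in>I. \<Sum>S\<in>I. p S T * (measure \<nu> (X \<inter> \<beta> T) / b T))"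
      by (rule sum.swap)
    also have "\<dots> = (\<Sum>S\<in>I. b S * (measure \<nu> (X \<inter> \<beta> S) / b S))"
      by (intro sum.cong refl) (simp only: sum_distrib_right[symmetric] p(3))
    also have "\<dots> = (\<Sum>S\<in>I. measure \<nu> (X \<inter> \<beta> S))"
      by (intro sum.cong refl **)
    finally show ?thesis using sum\<beta>[of I X] that \<beta>_UN by simp
  qed
  have sets_prod: "sets (\<mu> \<Otimes>\<^sub>M \<nu>) = sets borel"
    using sets_pair_measure_cong[OF sets_eq] borel_prod by metis
  have "\<pi> (Y \<union> Z) = \<pi> Y + \<pi> Z" if YZ: "Y \<in> sets borel" "Z \<in> sets borel" "Y \<inter> Z = {}" for Y Z
  proof -
    have "measure (\<mu> \<Otimes>\<^sub>M \<nu>) ((Y \<union> Z) \<inter> (\<alpha> S \<times> \<beta> T)) =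
      measure (\<mu> \<Otimes>\<^sub>M \<nu>) (Y \<inter> (\<alpha> S \<times> \<beta> T)) + measure (\<mu> \<Otimes>\<^sub>M \<nu>) (Z \<inter> (\<alpha> S \<times> \<beta> T))"
      if "S \<in> I" "T \<in> I" for S T
      unfolding Int_Un_distrib2 using YZ \<alpha>_borel[OF that(1)] \<beta>_borel[OF that(2)]
      by (intro P.finite_measure_Union) (auto simp: sets_prod)
    then show ?thesis unfolding \<pi>_def sum.distrib[symmetric]
      by (intro sum.cong) (auto simp: algebra_simps add_divide_distrib)
  qed
  moreover have "0 \<le> \<pi> Z" for Z
    unfolding \<pi>_def using p(1) by (intro sum_nonneg) (auto simp: a_def b_def)
  ultimately have "additive_coupling \<pi>"
    using marg1 marg2 by (auto simp: additive_coupling_def)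
  moreover have "capacity K \<le> \<pi> K"
  proof -
    have "capacity K \<le> cost (\<Union>S\<in>C. \<alpha> S, \<Union>T\<in>D. \<beta> T)"
    proof (rule capacity_le)
      show "(\<Union>S\<in>C. \<alpha> S, \<Union>T\<in>D. \<beta> T) \<in> covers K"
        using CD \<alpha>_borel \<beta>_borel finI unfolding covers_def K_eq
        by (auto intro!: sets.finite_UN intro: finite_subset) (blast+)?
    qed
    also have "\<dots> = sum a C + sum b D"
      using sum\<alpha>[of C UNIV] sum\<beta>[of D UNIV] CD by (simp add: cost_def a_def b_def)
    also have "\<dots> \<le> (\<Sum>(i, j)\<in>Q. p i j)" by (fact CD)
    also have "\<dots> = (\<Sum>(S, T)\<in>Q. p S T / (a S * b T) * measure (\<mu> \<Otimes>\<^sub>M \<nu>) (K \<inter> (\<alpha> S \<times> \<beta> T)))"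
    proof (rule sum.cong)
      fix ST assume "ST \<in> Q"
      moreover obtain S T where ST: "ST = (S, T)" by force
      ultimately have "S \<in> I" "T \<in> I" and "K \<inter> (\<alpha> S \<times> \<beta> T) = \<alpha> S \<times> \<beta> T"
        using Q by (auto simp: K_eq)
      then have "measure (\<mu> \<Otimes>\<^sub>M \<nu>) (K \<inter> (\<alpha> S \<times> \<beta> T)) = a S * b T"
        using \<alpha>_borel \<beta>_borel by (simp add: prod_eq a_def b_def)
      moreover have "p S T = 0" if "a S = 0 \<or> b T = 0"
        using p_le[of S T] p(1)[of S T] that \<open>S \<in> I\<close> \<open>T \<in> I\<close> by force
      ultimately show "(case ST of (i, j) \<Rightarrow> p i j) = (case ST of (S, T) \<Rightarrow>
          p S T / (a S * b T) * measure (\<mu> \<Otimes>\<^sub>M \<nu>) (K \<inter> (\<alpha> S \<times> \<beta> T)))"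
        by (auto simp: ST)
    qed simp
    also have "\<dots> \<le> \<pi> K"
      unfolding \<pi>_def using Q finI p(1) by (intro sum_mono2) (auto simp: a_def b_def)
    finally show ?thesis .
  qed
  ultimately show ?thesis unfolding K_def by blast
qed

lemma additive_coupling_mono:
  assumes "additive_coupling \<pi>" "S \<in> sets borel" "T \<in> sets borel" "S \<subseteq> T"
  shows "\<pi> S \<le> \<pi> T"
proof -
  have "T - S \<in> sets borel" "S \<inter> (T - S) = {}" using assms by auto
  then have "\<pi> (S \<union> (T - S)) = \<pi> S + \<pi> (T - S)" "0 \<le> \<pi> (T - S)"
    using assms(1,2) unfolding additive_coupling_def by blast+
  then show ?thesis using assms(4) by (simp add: Un_absorb1)
qed

text \<open>By \<open>capacity_Union_less\<close> a finite union of open rectangles inside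
  \<open>G\<close> already has capacity above \<open>r\<close>.\<close>

lemma open_coupling:
  assumes "open G" "r < capacity G"
  shows "\<exists>\<pi>. additive_coupling \<pi> \<and> r \<le> \<pi> G"
proof -
  obtain U V :: "nat \<Rightarrow> 'a set" where UV: "\<And>i. open (U i)" "\<And>i. open (V i)"
    and G: "G = (\<Union>i. U i \<times> V i)"
    using open_eq_UN_rectangles[OF assms(1)] by metis
  have G': "G = (\<Union>n. \<Union>i<n. U i \<times> V i)"
    unfolding G by auto
  have "\<exists>n. r < capacity (\<Union>i<n. U i \<times> V i)"
    using assms(2) unfolding G' by (rule capacity_Union_less[rotated]) (intro monoI UN_mono, auto)
  then obtain n where n: "r < capacity (\<Union>i<n. U i \<times> V i)" ..
  obtain \<pi> where \<pi>: "additive_coupling \<pi>"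
    "capacity (\<Union>i<n. U i \<times> V i) \<le> \<pi> (\<Union>i<n. U i \<times> V i)"
    using finite_rectangles_coupling[of U V n] UV by auto
  have "\<pi> (\<Union>i<n. U i \<times> V i) \<le> \<pi> G"
    using assms(1) UV by (intro additive_coupling_mono[OF \<pi>(1)] sets.finite_UN rectangle_borel)
      (auto simp: G)
  then show ?thesis using \<pi> n by (intro exI[of _ \<pi>]) auto
qed

text \<open>The entries of the codes are bounded one at a time; releasing one bound gives an
  increasing union, so \<open>capacity_Union_less\<close> finds a bound that keeps the capacity
  above \<open>r\<close>. All bounds together confine the codes to a compact product, so a point
  approximated by every \<open>H k n\<close> has a limiting code and lies in
  \<open>E\<close>.\<close>

lemma capacity_analytic:
  assumes "analytic E" and r: "r < capacity E"
  shows "\<exists>G. (\<forall>n. open (G n) \<and> r < capacity (G n)) \<and> decseq G \<and> (\<Inter>n. closure (G n)) \<subseteq> E"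
proof -
  obtain F :: "(('a \<times> 'a) \<times> (nat \<Rightarrow> nat)) set" where F: "closed F" "E = fst ` F"
    using assms(1) unfolding analytic_def by auto
  define H where "H = (\<lambda>k n. {z. \<exists>\<sigma>. (\<forall>i<n::nat. \<sigma> i \<le> (k i :: nat)) \<and> (z, \<sigma>) \<in> F})"
  have H_split: "H k n = (\<Union>m. H (k(n := m)) (Suc n))" for k n
  proof (intro set_eqI iffI)
    fix z assume "z \<in> H k n"
    then obtain \<sigma> where \<sigma>: "\<forall>i<n. \<sigma> i \<le> k i" "(z, \<sigma>) \<in> F" unfolding H_def by blast
    then have "\<forall>i<Suc n. \<sigma> i \<le> (k(n := \<sigma> n)) i" by (simp add: less_Suc_eq)
    then show "z \<in> (\<Union>m. H (k(n := m)) (Suc n))" using \<sigma>(2) unfolding H_def by blast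
  next
    fix z assume "z \<in> (\<Union>m. H (k(n := m)) (Suc n))"
    then obtain m \<sigma> where "\<forall>i<Suc n. \<sigma> i \<le> (k(n := m)) i" "(z, \<sigma>) \<in> F" unfolding H_def by blast
    then show "z \<in> H k n" unfolding H_def by (intro CollectI exI[of _ \<sigma>]) (auto simp: less_Suc_eq)
  qed
  have H_mono: "incseq (\<lambda>m. H (k(n := m)) (Suc n))" for k n
  proof (rule monoI, rule subsetI)
    fix m m' z assume "m \<le> m'" "z \<in> H (k(n := m)) (Suc n)"
    then obtain \<sigma> where \<sigma>: "\<forall>i<Suc n. \<sigma> i \<le> (k(n := m)) i" "(z, \<sigma>) \<in> F" unfolding H_def by blast
    have "\<sigma> i \<le> (k(n := m')) i" if "i < Suc n" for i
      using \<sigma>(1)[rule_format, OF that] \<open>m \<le> m'\<close> by (cases "i = n") auto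
    then show "z \<in> H (k(n := m')) (Suc n)" using \<sigma>(2) unfolding H_def by blast
  qed
  have "\<exists>f. \<forall>n. r < capacity (H (f n) n) \<and> (\<forall>i<n. f (Suc n) i = f n i)"
  proof (rule dependent_nat_choice)
    have "H (\<lambda>_. 0) 0 = E" unfolding H_def F(2) by force
    then show "\<exists>k. r < capacity (H k 0)" using r by metis
  next
    fix k n assume "r < capacity (H k n)"
    then have "r < capacity (\<Union>m. H (k(n := m)) (Suc n))" by (simp only: H_split[of k n])
    from capacity_Union_less[OF H_mono this]
    obtain m where "r < capacity (H (k(n := m)) (Suc n))" ..
    then show "\<exists>k'. r < capacity (H k' (Suc n)) \<and> (\<forall>i<n. k' i = k i)"
      by (intro exI[of _ "k(n := m)"]) simp
  qed
  then obtain f where f: "\<And>n. r < capacity (H (f n) n)" "\<And>n i. i < n \<Longrightarrow> f (Suc n) i = f n i"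
    by blast
  define k where "k = (\<lambda>i. f (Suc i) i)"
  have fk: "f n i = k i" if "i < n" for n i
    using that by (induction n) (auto simp: k_def less_Suc_eq f(2))
  have Hk: "r < capacity (H k n)" for n
  proof -
    have "H (f n) n = H k n" unfolding H_def using fk by simp
    then show ?thesis using f(1)[of n] by simp
  qed
  \<comment> \<open>Open, so that \<open>open_coupling\<close> applies, and with radii tending to
    \<open>0\<close>, so that a point in all the closures is a limit of points of the
    \<open>H k n\<close>.\<close>
  define G where "G = (\<lambda>n. \<Union>z\<in>H k n. ball z (1 / real (Suc n)))"
  have "open (G n)" for n by (auto simp: G_def)
  moreover have "r < capacity (G n)" for n
  proof -
    have "H k n \<subseteq> G n" by (auto simp: G_def)
    then show ?thesis using Hk[of n] capacity_mono by (meson less_le_trans)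
  qed
  moreover have "decseq G"
  proof (rule decseq_SucI)
    fix n
    have "H k (Suc n) \<subseteq> H k n" unfolding H_def using less_SucI by blast
    moreover have "ball z (1 / real (Suc (Suc n))) \<subseteq> ball z (1 / real (Suc n))" for z :: "'a \<times> 'a"
      by (intro subset_ball) (simp add: frac_le)
    ultimately show "G (Suc n) \<subseteq> G n" unfolding G_def by (rule UN_mono)
  qed
  moreover have "x \<in> E" if x: "x \<in> (\<Inter>n. closure (G n))" for x
  proof -
    have "\<exists>z \<sigma>. dist z x \<le> 2 / real (Suc n) \<and> (\<forall>i<n. \<sigma> i \<le> k i) \<and> (z, \<sigma>) \<in> F" for n
    proof -
      have "x \<in> closure (G n)" "0 < 1 / real (Suc n)" using x by auto
      then obtain y where y: "y \<in> G n" "dist y x < 1 / real (Suc n)"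
        unfolding closure_approachable by blast
      then obtain z where z: "z \<in> H k n" "dist z y < 1 / real (Suc n)" by (auto simp: G_def)
      have "dist z x \<le> dist z y + dist y x" by (rule dist_triangle)
      also have "\<dots> \<le> 1 / real (Suc n) + 1 / real (Suc n)" using y z by (intro add_mono less_imp_le)
      finally have "dist z x \<le> 2 / real (Suc n)" by simp
      then show ?thesis using z(1) unfolding H_def by blast
    qed
    then obtain z \<sigma> where z: "\<And>n. dist (z n) x \<le> 2 / real (Suc n)"
      and \<sigma>: "\<And>n i. i < n \<Longrightarrow> \<sigma> n i \<le> k i" and zF: "\<And>n. (z n, \<sigma> n) \<in> F" by metis
    have "(\<lambda>n. dist (z n) x) \<longlonglongrightarrow> 0"
    proof (rule tendsto_sandwich[of "\<lambda>_. 0" _ _ "\<lambda>n. 2 / real (Suc n)"])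
      show "(\<lambda>n. 2 / real (Suc n)) \<longlonglongrightarrow> 0" by (rule LIMSEQ_Suc[OF lim_const_over_n])
    qed (use z in auto)
    then have z_lim: "z \<longlonglongrightarrow> x" by (simp only: tendsto_dist_iff[of z])
    define K where "K = (PiE UNIV (\<lambda>i. {..k i}) :: (nat \<Rightarrow> nat) set)"
    have "compactin (product_topology (\<lambda>_. euclidean) UNIV) K"
      unfolding K_def by (simp add: compactin_PiE finite_imp_compact)
    then have "compact K" by (simp add: euclidean_product_topology)
    then have "seq_compact K" by (rule compact_imp_seq_compact)
    \<comment> \<open>Only the first \<open>n\<close> entries of \<open>\<sigma> n\<close> are
      bounded by \<open>k\<close>, so the sequence is cut off to lie in \<open>K\<close>. In each
      fixed coordinate the cut-off is eventually inactive and does not affect the limit.\<close>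
    moreover have "\<forall>n. (\<lambda>i. min (\<sigma> n i) (k i)) \<in> K" by (auto simp: K_def)
    ultimately obtain l \<rho> where \<rho>: "strict_mono \<rho>" "((\<lambda>n i. min (\<sigma> n i) (k i)) \<circ> \<rho>) \<longlonglongrightarrow> l"
      by (rule seq_compactE)
    have "(\<lambda>n. \<sigma> (\<rho> n)) \<longlonglongrightarrow> l"
      unfolding tendsto_fun_iff
    proof
      fix i
      have "(\<lambda>n. min (\<sigma> (\<rho> n) i) (k i)) \<longlonglongrightarrow> l i"
        using \<rho>(2) unfolding tendsto_fun_iff by (simp add: comp_def)
      moreover have "\<forall>\<^sub>F n in sequentially. min (\<sigma> (\<rho> n) i) (k i) = \<sigma> (\<rho> n) i"
        using eventually_gt_at_top[of i]
      proof eventually_elim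
        case (elim n)
        then show ?case using \<sigma>[of i "\<rho> n"] seq_suble[OF \<rho>(1), of n] by simp
      qed
      ultimately show "(\<lambda>n. \<sigma> (\<rho> n) i) \<longlonglongrightarrow> l i" by (rule Lim_transform_eventually)
    qed
    moreover have "(\<lambda>n. z (\<rho> n)) \<longlonglongrightarrow> x"
      using LIMSEQ_subseq_LIMSEQ[OF z_lim \<rho>(1)] by (simp add: comp_def)
    ultimately have "(\<lambda>n. (z (\<rho> n), \<sigma> (\<rho> n))) \<longlonglongrightarrow> (x, l)" by (intro tendsto_Pair)
    from closed_sequentially[OF F(1) zF this] show "x \<in> E" using F(2) by force
  qed
  ultimately show ?thesis by (intro exI[of _ G]) auto
qed

lemma additive_coupling_limit:
  fixes G :: "nat \<Rightarrow> ('a \<times> 'a) set"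
  assumes \<pi>: "\<And>n. additive_coupling (\<pi> n)" "\<And>n. r \<le> \<pi> n (G n)"
    and G: "\<And>n. G n \<in> sets borel" "decseq G"
  shows "\<exists>p. additive_coupling p \<and> (\<forall>n. r \<le> p (G n))"
proof -
  \<comment> \<open>Off the Borel sets \<open>\<pi> n\<close> is arbitrary; the value
    \<open>0\<close> there puts the function into the cube \<open>U\<close>.\<close>
  define \<pi>' where "\<pi>' = (\<lambda>n S. if S \<in> sets borel then \<pi> n S else 0)"
  define U where "U = (PiE UNIV (\<lambda>_. {0..1}) :: (('a \<times> 'a) set \<Rightarrow> real) set)"
  have "\<pi> n UNIV = 1" for n
    using \<pi>(1)[of n] left.prob_space unfolding additive_coupling_def
    by (metis UNIV_Times_UNIV sets.top space_borel space_eq(1))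
  then have "\<pi> n S \<le> 1" if "S \<in> sets borel" for n S
    using additive_coupling_mono[OF \<pi>(1) that, of UNIV n] by simp
  then have \<pi>'_U: "\<pi>' n \<in> U" for n
    using \<pi>(1)[of n] unfolding additive_coupling_def by (auto simp: U_def \<pi>'_def)
  have "compactin (product_topology (\<lambda>_. euclidean) UNIV) U"
    unfolding U_def by (simp add: compactin_PiE)
  then have "compact U" by (simp add: euclidean_product_topology)
  moreover have "filtermap \<pi>' sequentially \<noteq> bot" by (simp add: filtermap_bot_iff)
  moreover have "eventually (\<lambda>q. q \<in> U) (filtermap \<pi>' sequentially)"
    using \<pi>'_U by (simp add: eventually_filtermap)
  ultimately obtain p where p: "inf (nhds p) (filtermap \<pi>' sequentially) \<noteq> bot"
    unfolding compact_filter by blast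
  \<comment> \<open>In a product over all sets a cluster point need not be the limit of a
    subsequence. Along \<open>L\<close> the evaluations converge to those of \<open>p\<close>, and
    whatever holds eventually for \<open>\<pi>'\<close> still holds eventually.\<close>
  define L where "L = inf (nhds p) (filtermap \<pi>' sequentially)"
  have L: "L \<noteq> bot" using p by (simp add: L_def)
  have "((\<lambda>q. q) \<longlongrightarrow> p) L" unfolding L_def filterlim_def by (simp add: filtermap_ident)
  then have lim: "((\<lambda>q. q S) \<longlongrightarrow> p S) L" for S by (simp add: tendsto_fun_iff)
  have ev: "eventually P L" if "eventually (\<lambda>n. P (\<pi>' n)) sequentially" for P
    using that unfolding L_def by (intro filter_leD[OF inf_le2]) (simp add: eventually_filtermap)
  have "0 \<le> p S" if "S \<in> sets borel" for S
  proof (rule tendsto_lowerbound[OF lim _ L], rule ev)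
    show "\<forall>\<^sub>F n in sequentially. 0 \<le> \<pi>' n S"
      using \<pi>(1) that unfolding additive_coupling_def by (auto simp: \<pi>'_def)
  qed
  moreover have "p (S \<union> T) = p S + p T" if "S \<in> sets borel" "T \<in> sets borel" "S \<inter> T = {}" for S T
  proof (rule tendsto_unique[OF L])
    show "((\<lambda>q. q (S \<union> T)) \<longlongrightarrow> p (S \<union> T)) L" by (rule lim)
    have "\<forall>\<^sub>F q in L. q S + q T = q (S \<union> T)"
      using \<pi>(1) that unfolding additive_coupling_def by (intro ev) (auto simp: \<pi>'_def)
    with tendsto_add[OF lim lim] show "((\<lambda>q. q (S \<union> T)) \<longlongrightarrow> p S + p T) L"
      by (rule Lim_transform_eventually)
  qed
  moreover have "p (A \<times> UNIV) = measure \<mu> A" "p (UNIV \<times> A) = measure \<nu> A" if "A \<in> sets borel" for A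
  proof -
    have "\<forall>\<^sub>F q in L. measure \<mu> A = q (A \<times> UNIV)" "\<forall>\<^sub>F q in L. measure \<nu> A = q (UNIV \<times> A)"
      using \<pi>(1) that unfolding additive_coupling_def by (intro ev; simp add: \<pi>'_def rectangle_borel)+
    then have "((\<lambda>q. q (A \<times> UNIV)) \<longlongrightarrow> measure \<mu> A) L" "((\<lambda>q. q (UNIV \<times> A)) \<longlongrightarrow> measure \<nu> A) L"
      by (auto intro: Lim_transform_eventually[OF tendsto_const])
    then show "p (A \<times> UNIV) = measure \<mu> A" "p (UNIV \<times> A) = measure \<nu> A"
      using tendsto_unique[OF L lim] by blast+
  qed
  moreover have "r \<le> p (G n)" for n
  proof (rule tendsto_lowerbound[OF lim _ L], rule ev)
    show "\<forall>\<^sub>F m in sequentially. r \<le> \<pi>' m (G n)"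
      using eventually_ge_at_top[of n]
    proof eventually_elim
      case (elim m)
      have "\<pi> m (G m) \<le> \<pi> m (G n)"
        using G elim by (intro additive_coupling_mono[OF \<pi>(1)]) (auto simp: decseq_def)
      then show ?case using \<pi>(2)[of m] G(1) by (simp add: \<pi>'_def)
    qed
  qed
  ultimately show ?thesis unfolding additive_coupling_def by blast
qed

section \<open>From finite to countable additivity\<close>

lemma additive_coupling_subadditive:
  assumes "additive_coupling \<pi>" "S \<in> sets borel" "T \<in> sets borel"
  shows "\<pi> (S \<union> T) \<le> \<pi> S + \<pi> T"
proof -
  have "T - S \<in> sets borel" "S \<inter> (T - S) = {}" using assms by auto
  then have "\<pi> (S \<union> (T - S)) = \<pi> S + \<pi> (T - S)"
    using assms(1,2) unfolding additive_coupling_def by blast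
  moreover have "\<pi> (T - S) \<le> \<pi> T"
    using assms by (intro additive_coupling_mono) auto
  ultimately show ?thesis by simp
qed

lemma additive_coupling_empty:
  assumes "additive_coupling \<pi>"
  shows "\<pi> {} = 0"
proof -
  have "\<pi> ({} \<times> UNIV) = measure \<mu> {}"
    using assms unfolding additive_coupling_def by blast
  then show ?thesis by simp
qed

lemma additive_coupling_UN_le:
  assumes "additive_coupling \<pi>" "\<And>i. S i \<in> sets borel"
  shows "\<pi> (\<Union>i<n::nat. S i) \<le> (\<Sum>i<n. \<pi> (S i))"
proof (induction n)
  case (Suc n)
  have "\<pi> ((\<Union>i<n. S i) \<union> S n) \<le> \<pi> (\<Union>i<n. S i) + \<pi> (S n)"
    using assms(2) by (intro additive_coupling_subadditive[OF assms(1)] sets.finite_UN) auto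
  then show ?case using Suc by (simp add: lessThan_Suc Un_commute)
qed (simp add: additive_coupling_empty[OF assms(1)])

lemma additive_coupling_disjoint_UN:
  assumes "additive_coupling \<pi>" "\<And>i. S i \<in> sets borel" "disjoint_family S"
  shows "\<pi> (\<Union>i<n::nat. S i) = (\<Sum>i<n. \<pi> (S i))"
proof (induction n)
  case (Suc n)
  have "S n \<inter> S i = {}" if "i < n" for i
    using disjoint_family_onD[OF assms(3), of n i] that by simp
  then have "S n \<inter> (\<Union>i<n. S i) = {}" by blast
  moreover have "(\<Union>i<n. S i) \<in> sets borel" "S n \<in> sets borel" using assms(2) by (auto intro: sets.finite_UN)
  ultimately have "\<pi> (S n \<union> (\<Union>i<n. S i)) = \<pi> (S n) + \<pi> (\<Union>i<n. S i)"
    using assms(1) unfolding additive_coupling_def by blast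
  then show ?case using Suc by (simp add: lessThan_Suc)
qed (simp add: additive_coupling_empty[OF assms(1)])

text \<open>The difference of the rectangles lies in two strips, where \<open>\<pi>\<close> is known
  from the marginals. This carries the regularity of \<mu> and \<nu> over to rectangles.\<close>

lemma additive_coupling_rectangle_le:
  assumes \<pi>: "additive_coupling \<pi>"
    and [measurable]: "A \<in> sets borel" "B \<in> sets borel" "A' \<in> sets borel" "B' \<in> sets borel"
    and sub: "A \<subseteq> A'" "B \<subseteq> B'"
  shows "\<pi> (A' \<times> B') \<le> \<pi> (A \<times> B) + (measure \<mu> A' - measure \<mu> A) + (measure \<nu> B' - measure \<nu> B)"
proof -
  let ?N = "(A' - A) \<times> UNIV \<union> UNIV \<times> (B' - B)"
  have "\<pi> (A' \<times> B') \<le> \<pi> (A \<times> B \<union> ?N)"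
    by (rule additive_coupling_mono[OF \<pi>]) auto
  also have "\<dots> \<le> \<pi> (A \<times> B) + \<pi> ?N"
    by (rule additive_coupling_subadditive[OF \<pi>]) auto
  finally have "\<pi> (A' \<times> B') \<le> \<pi> (A \<times> B) + \<pi> ?N" .
  moreover have "\<pi> ?N \<le> \<pi> ((A' - A) \<times> UNIV) + \<pi> (UNIV \<times> (B' - B))"
    by (rule additive_coupling_subadditive[OF \<pi>]) auto
  moreover have "\<pi> ((A' - A) \<times> UNIV) = measure \<mu> (A' - A)" "\<pi> (UNIV \<times> (B' - B)) = measure \<nu> (B' - B)"
    using \<pi> unfolding additive_coupling_def by auto
  moreover have "measure \<mu> (A' - A) = measure \<mu> A' - measure \<mu> A"
    using sub by (intro left.finite_measure_Diff) (auto simp: sets_eq)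
  moreover have "measure \<nu> (B' - B) = measure \<nu> B' - measure \<nu> B"
    using sub by (intro right.finite_measure_Diff) (auto simp: sets_eq)
  ultimately show ?thesis by linarith
qed

text \<open>The marginals are countably additive and regular, which makes a finitely additive coupling
  countably additive on rectangles by compactness.\<close>

lemma additive_coupling_rectangle_sums:
  assumes \<pi>: "additive_coupling \<pi>"
    and AB: "\<And>i::nat. A i \<in> sets borel" "\<And>i. B i \<in> sets borel"
    and XY: "X \<in> sets borel" "Y \<in> sets borel"
    and disj: "disjoint_family (\<lambda>i. A i \<times> B i)" and eq: "(\<Union>i. A i \<times> B i) = X \<times> Y"
  shows "(\<lambda>i. \<pi> (A i \<times> B i)) sums \<pi> (X \<times> Y)"
proof -
  let ?s = "\<lambda>n. \<Sum>i<n. \<pi> (A i \<times> B i)"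
  have rect: "A i \<times> B i \<in> sets borel" for i using AB by (rule rectangle_borel)
  have nonneg: "0 \<le> \<pi> (A i \<times> B i)" for i using \<pi> rect unfolding additive_coupling_def by blast
  have upper: "?s n \<le> \<pi> (X \<times> Y)" for n
  proof -
    have "?s n = \<pi> (\<Union>i<n. A i \<times> B i)"
      using additive_coupling_disjoint_UN[OF \<pi> rect disj] by simp
    moreover have "(\<Union>i<n. A i \<times> B i) \<subseteq> X \<times> Y" unfolding eq[symmetric] by blast
    then have "\<pi> (\<Union>i<n. A i \<times> B i) \<le> \<pi> (X \<times> Y)"
      by (intro additive_coupling_mono[OF \<pi>] sets.finite_UN finite_lessThan rect rectangle_borel XY)
    ultimately show ?thesis by simp
  qed
  \<comment> \<open>Shrinking \<open>X\<close> and \<open>Y\<close> to compact sets costs less than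
    \<open>2 * \<epsilon>\<close>, enlarging all \<open>A i\<close> and \<open>B i\<close> to open
    sets at most \<open>2 * \<epsilon>\<close>; the factor \<open>5\<close> leaves room.\<close>
  have lower: "\<exists>n. \<pi> (X \<times> Y) < ?s n + 5 * \<epsilon>" if pos: "0 < \<epsilon>" for \<epsilon>
  proof -
    obtain K where K: "compact K" "K \<subseteq> X" "measure \<mu> X < measure \<mu> K + \<epsilon>"
      using inner_regular_compact[OF prob(1) sets_eq(1) XY(1) pos] by blast
    obtain L where L: "compact L" "L \<subseteq> Y" "measure \<nu> Y < measure \<nu> L + \<epsilon>"
      using inner_regular_compact[OF prob(2) sets_eq(2) XY(2) pos] by blast
    define e where "e = (\<lambda>i. \<epsilon> * (1/2) ^ Suc i)"
    have e: "0 < e i" for i using pos by (simp add: e_def)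
    have "\<exists>U. open U \<and> A i \<subseteq> U \<and> measure \<mu> U < measure \<mu> (A i) + e i" for i
      using outer_regular_open[OF prob(1) sets_eq(1) AB(1) e] .
    then obtain U where U: "\<And>i. open (U i)" "\<And>i. A i \<subseteq> U i" "\<And>i. measure \<mu> (U i) < measure \<mu> (A i) + e i"
      by metis
    have "\<exists>V. open V \<and> B i \<subseteq> V \<and> measure \<nu> V < measure \<nu> (B i) + e i" for i
      using outer_regular_open[OF prob(2) sets_eq(2) AB(2) e] .
    then obtain V where V: "\<And>i. open (V i)" "\<And>i. B i \<subseteq> V i" "\<And>i. measure \<nu> (V i) < measure \<nu> (B i) + e i"
      by metis
    have "K \<times> L \<subseteq> (\<Union>i. A i \<times> B i)" using K(2) L(2) unfolding eq by blast
    also have "\<dots> \<subseteq> (\<Union>i. U i \<times> V i)" using U(2) V(2) by (intro UN_mono Sigma_mono) auto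
    finally have cov: "K \<times> L \<subseteq> (\<Union>i. U i \<times> V i)" .
    obtain C where C: "finite C" "K \<times> L \<subseteq> (\<Union>i\<in>C. U i \<times> V i)"
      by (rule compactE_image[OF compact_Times[OF K(1) L(1)] open_Times[OF U(1) V(1)] cov])
    obtain n where n: "C \<subseteq> {..<n}" using C(1) finite_nat_iff_bounded by auto
    have KL: "K \<in> sets borel" "L \<in> sets borel" using K(1) L(1) by (auto intro: borel_compact)
    have UV: "U i \<in> sets borel" "V i \<in> sets borel" for i using U(1) V(1) by auto
    have "\<pi> (X \<times> Y) \<le> \<pi> (K \<times> L) + (measure \<mu> X - measure \<mu> K) + (measure \<nu> Y - measure \<nu> L)"
      using K(2) L(2) KL XY by (intro additive_coupling_rectangle_le[OF \<pi>])
    moreover have "(\<Union>i\<in>C. U i \<times> V i) \<subseteq> (\<Union>i<n. U i \<times> V i)" using n by (rule UN_mono) simp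
    then have "\<pi> (K \<times> L) \<le> \<pi> (\<Union>i<n. U i \<times> V i)"
      using C(2) KL UV by (intro additive_coupling_mono[OF \<pi>] rectangle_borel sets.finite_UN) auto
    moreover have "\<pi> (\<Union>i<n. U i \<times> V i) \<le> ?s n + 2 * \<epsilon>"
    proof -
      have "\<pi> (\<Union>i<n. U i \<times> V i) \<le> (\<Sum>i<n. \<pi> (U i \<times> V i))"
        using UV by (intro additive_coupling_UN_le[OF \<pi>] rectangle_borel)
      also have "\<dots> \<le> (\<Sum>i<n. \<pi> (A i \<times> B i) + 2 * e i)"
      proof (rule sum_mono)
        fix i
        have "\<pi> (U i \<times> V i) \<le> \<pi> (A i \<times> B i) + (measure \<mu> (U i) - measure \<mu> (A i)) + (measure \<nu> (V i) - measure \<nu> (B i))"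
          using U(2) V(2) UV AB by (intro additive_coupling_rectangle_le[OF \<pi>])
        then show "\<pi> (U i \<times> V i) \<le> \<pi> (A i \<times> B i) + 2 * e i" using U(3)[of i] V(3)[of i] by linarith
      qed
      also have "\<dots> = ?s n + 2 * (\<Sum>i<n. e i)" by (simp add: sum.distrib sum_distrib_left)
      also have "(\<Sum>i<n. e i) = \<epsilon> * (1 - (1/2) ^ n)"
        by (induction n) (auto simp: e_def algebra_simps)
      finally have "\<pi> (\<Union>i<n. U i \<times> V i) \<le> ?s n + 2 * (\<epsilon> * (1 - (1/2) ^ n))" .
      moreover have "\<epsilon> * (1 - (1/2) ^ n) \<le> \<epsilon>" using pos by (simp add: mult_le_cancel_left1)
      ultimately show ?thesis by linarith
    qed
    ultimately have "\<pi> (X \<times> Y) < ?s n + 5 * \<epsilon>" using K(3) L(3) pos by linarith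
    then show ?thesis ..
  qed
  have "?s \<longlonglongrightarrow> \<pi> (X \<times> Y)"
  proof (rule metric_LIMSEQ_I)
    fix r :: real assume "0 < r"
    then obtain n where n: "\<pi> (X \<times> Y) < ?s n + r" using lower[of "r / 5"] by auto
    have "?s n \<le> ?s m" if "n \<le> m" for m
      using that nonneg by (intro sum_mono2) auto
    then have "dist (?s m) (\<pi> (X \<times> Y)) < r" if "n \<le> m" for m
      using that n upper[of m] by (force simp: dist_real_def)
    then show "\<exists>N. \<forall>m\<ge>N. dist (?s m) (\<pi> (X \<times> Y)) < r" by blast
  qed
  then show ?thesis by (simp add: sums_def)
qed

text \<open>Caratheodory extension from the semiring of rectangles, where
  \<open>additive_coupling_rectangle_sums\<close> provides countable additivity. Agreement is
  claimed on rectangles only: on other Borel sets \<open>P\<close> may differ from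
  \<open>\<pi>\<close>.\<close>

lemma additive_coupling_extends:
  assumes \<pi>: "additive_coupling \<pi>"
  shows "\<exists>P. prob_space P \<and> sets P = sets borel \<and>
    (\<forall>A\<in>sets borel. \<forall>B\<in>sets borel. measure P (A \<times> B) = \<pi> (A \<times> B))"
proof -
  define R where "R = {A \<times> B | (A :: 'a set) (B :: 'a set). A \<in> sets borel \<and> B \<in> sets borel}"
  have R_I: "A \<times> B \<in> R" if "A \<in> sets borel" "B \<in> sets borel" for A B
    using that by (auto simp: R_def)
  have R_borel: "S \<in> sets borel" if "S \<in> R" for S
    using that unfolding R_def by (auto intro!: rectangle_borel)
  have nonneg: "0 \<le> \<pi> S" if "S \<in> R" for S
    using \<pi> R_borel[OF that] unfolding additive_coupling_def by blast
  interpret semiring_of_sets UNIV R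
  proof
    show "R \<subseteq> Pow UNIV" by simp
    show "{} \<in> R" using R_I[of "{}" "{}"] by simp
  next
    fix S T assume "S \<in> R" "T \<in> R"
    then obtain A B C D where AB: "S = A \<times> B" "T = C \<times> D"
      "A \<in> sets borel" "B \<in> sets borel" "C \<in> sets borel" "D \<in> sets borel" by (auto simp: R_def)
    show "S \<inter> T \<in> R" unfolding AB Times_Int_Times by (intro R_I) (use AB in auto)
    have "S - T = \<Union>{(A - C) \<times> B, (A \<inter> C) \<times> (B - D)}" unfolding AB by auto
    moreover have "disjoint {(A - C) \<times> B, (A \<inter> C) \<times> (B - D)}" unfolding disjoint_def by auto
    moreover have "{(A - C) \<times> B, (A \<inter> C) \<times> (B - D)} \<subseteq> R"
      using AB by (auto intro!: R_I)
    ultimately show "\<exists>C\<subseteq>R. finite C \<and> disjoint C \<and> S - T = \<Union>C"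
      by (intro exI[of _ "{(A - C) \<times> B, (A \<inter> C) \<times> (B - D)}"]) blast
  qed
  define f where "f = (\<lambda>S. ennreal (\<pi> S))"
  have "countably_additive R f"
  proof (rule countably_additiveI)
    fix S :: "nat \<Rightarrow> ('a \<times> 'a) set"
    assume S: "range S \<subseteq> R" "disjoint_family S" "\<Union> (range S) \<in> R"
    have "S i \<in> R" for i using S(1) by auto
    then have "\<forall>i. \<exists>A B. S i = A \<times> B \<and> A \<in> sets borel \<and> B \<in> sets borel"
      unfolding R_def by blast
    then obtain A B where AB: "\<And>i. S i = A i \<times> B i" "\<And>i. A i \<in> sets borel" "\<And>i. B i \<in> sets borel"
      by metis
    obtain X Y where XY: "\<Union> (range S) = X \<times> Y" "X \<in> sets borel" "Y \<in> sets borel"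
      using S(3) by (auto simp: R_def)
    have "(\<lambda>i. \<pi> (S i)) sums \<pi> (\<Union> (range S))"
      unfolding XY(1) unfolding AB(1)
    proof (rule additive_coupling_rectangle_sums[OF \<pi> AB(2,3) XY(2,3)])
      show "disjoint_family (\<lambda>i. A i \<times> B i)" "(\<Union>i. A i \<times> B i) = X \<times> Y"
        using S(2) XY(1) unfolding AB(1)[symmetric] by simp_all
    qed
    then have "(\<lambda>i. ennreal (\<pi> (S i))) sums ennreal (\<pi> (\<Union> (range S)))"
      using S(1) nonneg by (subst sums_ennreal) (auto intro: nonneg S(3))
    then show "(\<Sum>i. f (S i)) = f (\<Union> (range S))"
      by (simp add: f_def sums_iff)
  qed
  moreover have "positive R f" by (simp add: positive_def f_def additive_coupling_empty[OF \<pi>])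
  ultimately obtain m where m: "\<forall>S\<in>R. m S = f S" "measure_space UNIV (sigma_sets UNIV R) m"
    using caratheodory by blast
  define P where "P = measure_of UNIV R m"
  have sets_P': "sets P = sigma_sets UNIV R" unfolding P_def by (rule sets_measure_of) simp
  also have "\<dots> = sets (borel \<Otimes>\<^sub>M borel)" by (simp add: sets_pair_measure R_def)
  finally have sets_P: "sets P = sets borel" unfolding borel_prod .
  have P_rect: "emeasure P S = ennreal (\<pi> S)" if "S \<in> R" for S
  proof -
    have "emeasure P S = m S"
    proof (rule emeasure_measure_of[OF P_def])
      show "positive (sets P) m" "countably_additive (sets P) m"
        using m(2) unfolding sets_P' measure_space_def by simp_all
      show "S \<in> sets P" unfolding sets_P' using that by (rule sigma_sets.Basic)
    qed simp
    then show ?thesis using m(1) that by (simp add: f_def)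
  qed
  have "\<pi> (UNIV \<times> UNIV) = measure \<mu> UNIV"
    using \<pi>[unfolded additive_coupling_def, THEN conjunct2, THEN conjunct2, rule_format, of UNIV] by simp
  then have "\<pi> (UNIV \<times> UNIV) = 1" using left.prob_space by simp
  with P_rect[OF R_I[of UNIV UNIV]] have "emeasure P (UNIV \<times> UNIV) = 1" by simp
  then have "prob_space P" using sets_eq_imp_space_eq[OF sets_P] by (intro prob_spaceI) simp
  moreover have "measure P S = \<pi> S" if "S \<in> R" for S
    using P_rect[OF that] nonneg[OF that] by (simp add: measure_def)
  ultimately show ?thesis using sets_P R_I by (intro exI[of _ P]) simp
qed

text \<open>\<open>P\<close> and \<open>\<pi>\<close> agree on finite unions of rectangles. Along an
  increasing sequence of these with union \<open>G\<close>, \<open>P\<close> is continuous but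
  \<open>\<pi>\<close> merely monotone, which gives this direction; complements reverse it for
  closed sets.\<close>

lemma extension_open_le:
  assumes \<pi>: "additive_coupling \<pi>" and P: "prob_space P" "sets P = sets borel"
    and rect: "\<And>A B. A \<in> sets borel \<Longrightarrow> B \<in> sets borel \<Longrightarrow> measure P (A \<times> B) = \<pi> (A \<times> B)"
    and G: "open G"
  shows "measure P G \<le> \<pi> G"
proof -
  interpret P: prob_space P by fact
  have union: "measure P (\<Union>i<n. A i \<times> B i) = \<pi> (\<Union>i<n. A i \<times> B i)"
    if "\<And>i. A i \<in> sets borel" "\<And>i. B i \<in> sets borel" for n :: nat and A B
    using that
  proof (induction n arbitrary: A B)
    case 0
    then show ?case by (simp add: additive_coupling_empty[OF \<pi>])
  next
    case (Suc n)
    define W where "W = (\<Union>i<n. A i \<times> B i)"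
    define T where "T = A n \<times> B n"
    have W: "W \<in> sets borel" and T: "T \<in> sets borel"
      unfolding W_def T_def using Suc.prems by (intro sets.finite_UN rectangle_borel; simp)+
    \<comment> \<open>The intersection is again a union of \<open>n\<close> rectangles, but of other
      sets; this is why the induction generalises \<open>A\<close> and \<open>B\<close>.\<close>
    have "W \<inter> T = (\<Union>i<n. (A i \<inter> A n) \<times> (B i \<inter> B n))" unfolding W_def T_def by auto
    then have WT: "measure P (W \<inter> T) = \<pi> (W \<inter> T)"
      using Suc.IH[of "\<lambda>i. A i \<inter> A n" "\<lambda>i. B i \<inter> B n"] Suc.prems by simp
    have add: "\<pi> (S \<union> S') = \<pi> S + \<pi> S'" if "S \<in> sets borel" "S' \<in> sets borel" "S \<inter> S' = {}" for S S'
      using \<pi> that unfolding additive_coupling_def by blast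
    have "\<pi> (W \<union> (T - W)) = \<pi> W + \<pi> (T - W)" by (rule add) (use W T in auto)
    moreover have "\<pi> ((W \<inter> T) \<union> (T - W)) = \<pi> (W \<inter> T) + \<pi> (T - W)" by (rule add) (use W T in auto)
    moreover have "(W \<inter> T) \<union> (T - W) = T" "W \<union> (T - W) = W \<union> T" by auto
    moreover have "measure P (W \<union> T) + measure P (W \<inter> T) = measure P W + measure P T"
      by (rule P.measure_Un_Int) (use W T P(2) in auto)
    moreover have "measure P W = \<pi> W" unfolding W_def using Suc by blast
    moreover have "measure P T = \<pi> T" unfolding T_def using Suc.prems by (intro rect)
    ultimately have "measure P (W \<union> T) = \<pi> (W \<union> T)" using WT by simp
    moreover have "(\<Union>i<Suc n. A i \<times> B i) = W \<union> T" unfolding W_def T_def lessThan_Suc by auto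
    ultimately show ?case by simp
  qed
  obtain U V :: "nat \<Rightarrow> 'a set" where UV: "\<And>i. open (U i)" "\<And>i. open (V i)"
    and G_eq: "G = (\<Union>i. U i \<times> V i)"
    using open_eq_UN_rectangles[OF G] by metis
  have UV': "U i \<in> sets borel" "V i \<in> sets borel" for i using UV by auto
  have "(\<lambda>n. measure P (\<Union>i<n. U i \<times> V i)) \<longlonglongrightarrow> measure P (\<Union>n. \<Union>i<n. U i \<times> V i)"
  proof (rule P.finite_Lim_measure_incseq)
    show "incseq (\<lambda>n. \<Union>i<n. U i \<times> V i)" by (intro monoI UN_mono) auto
    show "range (\<lambda>n. \<Union>i<n. U i \<times> V i) \<subseteq> sets P"
      using UV' unfolding P(2) by (intro image_subsetI sets.finite_UN rectangle_borel) auto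
  qed
  moreover have "(\<Union>n. \<Union>i<n. U i \<times> V i) = G" unfolding G_eq by auto
  ultimately have "(\<lambda>n. measure P (\<Union>i<n. U i \<times> V i)) \<longlonglongrightarrow> measure P G" by simp
  moreover have "measure P (\<Union>i<n. U i \<times> V i) \<le> \<pi> G" for n
  proof -
    have "(\<Union>i<n. U i \<times> V i) \<subseteq> G" unfolding G_eq by auto
    then have "\<pi> (\<Union>i<n. U i \<times> V i) \<le> \<pi> G"
      using UV' G by (intro additive_coupling_mono[OF \<pi>] sets.finite_UN rectangle_borel) auto
    then show ?thesis using union[of U V n] UV' by simp
  qed
  ultimately show ?thesis by (intro LIMSEQ_le_const2) auto
qed

theorem capacity_duality:
  assumes E: "E \<in> sets borel" and r: "r < capacity E"
  shows "\<exists>P. prob_space P \<and> sets P = sets borel \<and> r \<le> measure P E \<and>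
    (\<forall>A\<in>sets borel. measure P (A \<times> UNIV) = measure \<mu> A \<and> measure P (UNIV \<times> A) = measure \<nu> A)"
proof -
  obtain G where G: "\<And>n. open (G n)" "\<And>n. r < capacity (G n)" "decseq G" "(\<Inter>n. closure (G n)) \<subseteq> E"
    using capacity_analytic[OF analytic_borel[OF E] r] by blast
  have "\<exists>\<pi>. additive_coupling \<pi> \<and> r \<le> \<pi> (G n)" for n
    using open_coupling[OF G(1,2)] .
  then obtain p where p: "\<And>n. additive_coupling (p n)" "\<And>n. r \<le> p n (G n)" by metis
  have "G n \<in> sets borel" for n using G(1) by auto
  from additive_coupling_limit[OF p this G(3)]
  obtain \<pi> where \<pi>: "additive_coupling \<pi>" "\<And>n. r \<le> \<pi> (G n)" by blast
  obtain P where P: "prob_space P" "sets P = sets borel"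
    and rect: "\<And>A B. A \<in> sets borel \<Longrightarrow> B \<in> sets borel \<Longrightarrow> measure P (A \<times> B) = \<pi> (A \<times> B)"
    using additive_coupling_extends[OF \<pi>(1)] by blast
  interpret P: prob_space P by fact
  have space_P: "space P = UNIV" using sets_eq_imp_space_eq[OF P(2)] by simp
  have marg: "\<pi> (A \<times> UNIV) = measure \<mu> A" "\<pi> (UNIV \<times> A) = measure \<nu> A" if "A \<in> sets borel" for A
    using \<pi>(1) that unfolding additive_coupling_def by blast+
  \<comment> \<open>A lower bound for \<open>\<pi>\<close> passes to \<open>P\<close> on closed
    sets, by \<open>extension_open_le\<close> for the complement; on the open sets
    \<open>G n\<close> the comparison goes the wrong way. Hence the closures in
    \<open>capacity_analytic\<close>.\<close>
  have "r \<le> measure P (closure (G n))" for n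
  proof -
    let ?F = "closure (G n)"
    have F: "?F \<in> sets borel" "- ?F \<in> sets borel" by auto
    have "\<pi> (?F \<union> - ?F) = \<pi> ?F + \<pi> (- ?F)"
      using \<pi>(1)[unfolded additive_coupling_def, THEN conjunct2, THEN conjunct1, rule_format, OF F] by simp
    moreover have "\<pi> (?F \<union> - ?F) = 1"
      using marg(1)[of UNIV] left.prob_space by simp
    moreover have "measure P (- ?F) \<le> \<pi> (- ?F)"
      by (rule extension_open_le[OF \<pi>(1) P rect]) (auto intro: open_Compl)
    moreover have "measure P (- ?F) = 1 - measure P ?F"
      using P.prob_compl[of ?F] F by (simp add: space_P P(2) Compl_eq_Diff_UNIV)
    moreover have "\<pi> (G n) \<le> \<pi> ?F"
      using F G(1) by (intro additive_coupling_mono[OF \<pi>(1)] closure_subset) auto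
    ultimately show ?thesis using \<pi>(2)[of n] by linarith
  qed
  moreover have "(\<lambda>n. measure P (closure (G n))) \<longlonglongrightarrow> measure P (\<Inter>n. closure (G n))"
  proof (rule P.finite_Lim_measure_decseq)
    show "decseq (\<lambda>n. closure (G n))" using G(3) by (auto simp: decseq_def intro!: closure_mono)
  qed (auto simp: P(2))
  ultimately have "r \<le> measure P (\<Inter>n. closure (G n))" by (intro LIMSEQ_le_const) auto
  also have "\<dots> \<le> measure P E" using G(4) E by (intro P.finite_measure_mono) (auto simp: P(2))
  finally show ?thesis using P rect marg by (intro exI[of _ P]) simp
qed

end

subsection \<open>Invariant sets\<close>

text \<open>The strip over a universally measurable set may lie outside the product sigma-field;
  \<open>coupling_bound\<close> uses the strips over these approximations instead.\<close>

lemma completion_sandwich: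
  assumes "A \<in> sets (completion M)"
  obtains I O' where "I \<in> sets M" "O' \<in> sets M" "I \<subseteq> A" "A \<subseteq> O'"
    "measure M I = measure (completion M) A" "measure M O' = measure (completion M) A"
proof -
  obtain O' where "O' \<in> sets M" "A \<subseteq> O'" "emeasure (completion M) A = emeasure M O'"
    using completion_upper[OF assms] by blast
  moreover have "main_part M A \<in> sets M" using assms by (rule main_part_sets)
  moreover have "main_part M A \<subseteq> A" using main_part_null_part_Un[OF assms] by blast
  moreover have "emeasure (completion M) A = emeasure M (main_part M A)"
    using assms by (rule emeasure_completion)
  ultimately show ?thesis using that[of "main_part M A" O'] by (simp add: measure_def)
qed

lemma coupling_bound:
  assumes E: "measurable_equiv M E"
    and \<mu>: "\<mu> \<in> space (prob_algebra M)" and \<nu>: "\<nu> \<in> space (prob_algebra M)"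
    and P: "P \<in> couplings M \<mu> \<nu>" and A: "A \<in> invariant_universal_sets M E"
  shows "\<bar>measure (completion \<mu>) A - measure (completion \<nu>) A\<bar> \<le> 1 - measure P E"
proof -
  have sets: "sets \<mu> = sets M" "sets \<nu> = sets M" and probs: "prob_space \<mu>" "prob_space \<nu>"
    using \<mu> \<nu> by (auto simp: space_prob_algebra)
  have P_sets: "sets P = sets (M \<Otimes>\<^sub>M M)" and P_prob: "prob_space P"
    and marg: "\<And>A. A \<in> sets M \<Longrightarrow> measure P (A \<times> space M) = measure \<mu> A"
      "\<And>A. A \<in> sets M \<Longrightarrow> measure P (space M \<times> A) = measure \<nu> A"
    using P by (auto simp: couplings_def space_prob_algebra)
  interpret P: prob_space P by fact
  interpret \<mu>: prob_space \<mu> by fact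
  interpret \<nu>: prob_space \<nu> by fact
  have E_sets: "E \<in> sets P" using E by (simp add: measurable_equiv_def P_sets)
  have P_E: "measure P (space P - E) = 1 - measure P E" using P.prob_compl[OF E_sets] .
  have space_P: "space P = space M \<times> space M"
    using sets_eq_imp_space_eq[OF P_sets] by (simp add: space_pair_measure)
  have inv: "x \<in> A \<longleftrightarrow> y \<in> A" if "(x, y) \<in> E" for x y
    using A that by (force simp: invariant_universal_sets_def indicator_def split: if_splits)
  have "A \<in> sets (completion \<mu>)" "A \<in> sets (completion \<nu>)"
    using A \<mu> \<nu> by (auto simp: invariant_universal_sets_def universal_sets_def)
  then obtain I1 O1 I2 O2 where
    1: "I1 \<in> sets \<mu>" "O1 \<in> sets \<mu>" "I1 \<subseteq> A" "A \<subseteq> O1"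
      "measure \<mu> I1 = measure (completion \<mu>) A" "measure \<mu> O1 = measure (completion \<mu>) A" and
    2: "I2 \<in> sets \<nu>" "O2 \<in> sets \<nu>" "I2 \<subseteq> A" "A \<subseteq> O2"
      "measure \<nu> I2 = measure (completion \<nu>) A" "measure \<nu> O2 = measure (completion \<nu>) A"
    by (elim completion_sandwich) blast
  \<comment> \<open>\<open>I\<close> will come from one marginal and \<open>O'\<close> from the
    other. Neither need be invariant, but the invariant \<open>A\<close> lies between: for
    \<open>(x, y)\<close> in \<open>E\<close>, \<open>x\<close> in \<open>I\<close> gives
    \<open>x\<close> in \<open>A\<close>, hence \<open>y\<close> in \<open>A\<close> and in
    \<open>O'\<close>.\<close>
  have *: "measure P (I \<times> space M) - measure P (space M \<times> O') \<le> 1 - measure P E"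
    "measure P (space M \<times> I) - measure P (O' \<times> space M) \<le> 1 - measure P E"
    if IO: "I \<in> sets M" "O' \<in> sets M" "I \<subseteq> A" "A \<subseteq> O'" for I O'
  proof -
    have rect: "I \<times> space M \<in> sets P" "space M \<times> I \<in> sets P" "O' \<times> space M \<in> sets P" "space M \<times> O' \<in> sets P"
      using IO by (auto simp: P_sets)
    have "I \<subseteq> space M" using IO(1) by (rule sets.sets_into_space)
    have "I \<times> space M \<subseteq> (space M \<times> O') \<union> (space P - E)" "space M \<times> I \<subseteq> (O' \<times> space M) \<union> (space P - E)"
      using inv IO \<open>I \<subseteq> space M\<close> unfolding space_P by blast+
    then have "measure P (I \<times> space M) \<le> measure P ((space M \<times> O') \<union> (space P - E))"
      "measure P (space M \<times> I) \<le> measure P ((O' \<times> space M) \<union> (space P - E))"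
      using rect E_sets by (auto intro!: P.finite_measure_mono)
    moreover have "measure P ((space M \<times> O') \<union> (space P - E)) \<le> measure P (space M \<times> O') + measure P (space P - E)"
      "measure P ((O' \<times> space M) \<union> (space P - E)) \<le> measure P (O' \<times> space M) + measure P (space P - E)"
      using rect E_sets by (auto intro!: measure_Un_le)
    ultimately show "measure P (I \<times> space M) - measure P (space M \<times> O') \<le> 1 - measure P E"
      "measure P (space M \<times> I) - measure P (O' \<times> space M) \<le> 1 - measure P E"
      using P_E by linarith+
  qed
  have "measure P (I1 \<times> space M) - measure P (space M \<times> O2) \<le> 1 - measure P E"
    using 1 2 sets by (intro *) auto
  moreover have "measure P (space M \<times> I2) - measure P (O1 \<times> space M) \<le> 1 - measure P E"
    using 1 2 sets by (intro *) auto
  ultimately show ?thesis using 1 2 sets by (simp add: marg)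
qed

text \<open>The problem moves to the Baire space by pushing \<mu> and \<nu> forward along
  \<open>\<psi>\<close> and pulling \<open>E\<close> back along \<open>\<theta>\<close> in both
  coordinates. As \<open>\<theta>\<close> is total, \<open>E'\<close> is an equivalence relation on
  the whole Baire space. A coupling found there is pushed forward along \<open>\<Theta>\<close>, and
  \<open>\<theta> (\<psi> x) = x\<close> restores the marginals.\<close>

lemma near_optimal_coupling:
  fixes M :: "'a measure" and E :: "('a \<times> 'a) set" and \<mu> \<nu> :: "'a measure"
  assumes M: "standard_borel_space M" and E: "measurable_equiv M E"
    and \<mu>: "\<mu> \<in> space (prob_algebra M)" and \<nu>: "\<nu> \<in> space (prob_algebra M)"
    and t: "t < 1 - variation_dist (invariant_universal_sets M E) \<mu> \<nu>"
  shows "\<exists>P\<in>couplings M \<mu> \<nu>. t \<le> measure P E"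
proof -
  let ?V = "variation_dist (invariant_universal_sets M E) \<mu> \<nu>"
  have sets: "sets \<mu> = sets M" "sets \<nu> = sets M" and probs: "prob_space \<mu>" "prob_space \<nu>"
    using \<mu> \<nu> by (auto simp: space_prob_algebra)
  interpret \<mu>: prob_space \<mu> by fact
  interpret \<nu>: prob_space \<nu> by fact
  have spaces: "space \<mu> = space M" "space \<nu> = space M" using sets by (auto dest: sets_eq_imp_space_eq)
  have "space M \<noteq> {}" using \<mu>.not_empty spaces by simp
  obtain \<psi> :: "'a \<Rightarrow> nat \<Rightarrow> nat discrete" and \<theta> where \<psi>: "\<psi> \<in> measurable M borel"
    and \<theta>: "\<theta> \<in> measurable borel M" and \<theta>\<psi>: "\<And>x. x \<in> space M \<Longrightarrow> \<theta> (\<psi> x) = x"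
    by (rule standard_borel_retract[OF M \<open>space M \<noteq> {}\<close>]) blast
  have \<psi>_\<mu>: "\<psi> \<in> measurable \<mu> borel" and \<psi>_\<nu>: "\<psi> \<in> measurable \<nu> borel"
    unfolding measurable_cong_sets[OF sets(1) refl] measurable_cong_sets[OF sets(2) refl]
    by (rule \<psi>)+
  have E_sets: "E \<in> sets (M \<Otimes>\<^sub>M M)" and E_equiv: "equiv (space M) E"
    using E by (auto simp: measurable_equiv_def)
  interpret B: borel_prob_pair "distr \<mu> borel \<psi>" "distr \<nu> borel \<psi>"
    by (rule borel_prob_pair.intro[OF \<mu>.prob_space_distr[OF \<psi>_\<mu>] \<nu>.prob_space_distr[OF \<psi>_\<nu>] sets_distr sets_distr])
  have m\<mu>: "measure (distr \<mu> borel \<psi>) A = measure \<mu> (\<psi> -` A \<inter> space M)"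
    and m\<nu>: "measure (distr \<nu> borel \<psi>) A = measure \<nu> (\<psi> -` A \<inter> space M)" if "A \<in> sets borel" for A
    using measure_distr[OF \<psi>_\<mu> that] measure_distr[OF \<psi>_\<nu> that] spaces by auto
  define \<Theta> where "\<Theta> = (\<lambda>z. (\<theta> (fst z), \<theta> (snd z)))"
  have "\<Theta> \<in> measurable (borel \<Otimes>\<^sub>M borel) (M \<Otimes>\<^sub>M M)"
    unfolding \<Theta>_def by (intro measurable_Pair measurable_compose[OF measurable_fst \<theta>]
        measurable_compose[OF measurable_snd \<theta>])
  then have \<Theta>: "\<Theta> \<in> measurable borel (M \<Otimes>\<^sub>M M)" by (simp add: borel_prod)
  define E' where "E' = \<Theta> -` E"
  have E'_borel: "E' \<in> sets borel" using measurable_sets[OF \<Theta> E_sets] by (simp add: E'_def)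
  have \<theta>_space: "\<theta> \<sigma> \<in> space M" for \<sigma> using measurable_space[OF \<theta>, of \<sigma>] by simp
  have E'_equiv: "equiv UNIV E'"
  proof (rule equivI)
    show "refl E'" using E_equiv \<theta>_space
      by (auto simp: E'_def \<Theta>_def equiv_def refl_on_def)
    show "sym E'" using E_equiv unfolding equiv_def E'_def \<Theta>_def sym_def by auto
    show "trans E'" using E_equiv unfolding equiv_def E'_def \<Theta>_def trans_def by auto
  qed auto
  have V_ge: "\<bar>measure (completion \<mu>) A - measure (completion \<nu>) A\<bar> \<le> ?V"
    if "A \<in> invariant_universal_sets M E" for A
    unfolding variation_dist_def
  proof (rule cSUP_upper[OF that])
    interpret c\<mu>: prob_space "completion \<mu>" by (rule \<mu>.prob_space_completion)
    interpret c\<nu>: prob_space "completion \<nu>" by (rule \<nu>.prob_space_completion)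
    show "bdd_above ((\<lambda>A. \<bar>measure (completion \<mu>) A - measure (completion \<nu>) A\<bar>) ` invariant_universal_sets M E)"
    proof (rule bdd_aboveI2)
      fix A
      show "\<bar>measure (completion \<mu>) A - measure (completion \<nu>) A\<bar> \<le> 1"
        using c\<mu>.prob_le_1[of A] c\<nu>.prob_le_1[of A] measure_nonneg[of "completion \<mu>" A]
          measure_nonneg[of "completion \<nu>" A] by linarith
    qed
  qed
  have "1 - ?V \<le> B.capacity E'"
  proof (rule B.le_capacity)
    fix X assume "X \<in> B.covers E'"
    then obtain C D where X: "X = (C, D)" and CD: "C \<in> sets borel" "D \<in> sets borel"
      "E' \<subseteq> C \<times> UNIV \<union> UNIV \<times> D" by (auto simp: B.covers_def)
    have "E' \<inter> (- C) \<times> (- D) = {}" using CD(3) by blast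
    moreover have "- C \<in> sets borel" "- D \<in> sets borel" using CD(1,2) by auto
    ultimately obtain U where U: "U \<in> sets borel" "- C \<subseteq> U" "U \<inter> - D = {}"
      "\<forall>(x, y)\<in>E'. x \<in> U \<longleftrightarrow> y \<in> U"
      using borel_invariant_separation[OF _ _ E'_borel E'_equiv, of "- C" "- D"] by blast
    define A where "A = \<psi> -` U \<inter> space M"
    have A: "A \<in> sets M" using measurable_sets[OF \<psi> U(1)] by (simp add: A_def)
    have "A \<in> universal_sets M"
      using A sets.sets_into_space[OF A] by (auto simp: universal_sets_def space_prob_algebra intro: sets_completionI_sets)
    moreover have "x \<in> A \<longleftrightarrow> y \<in> A" if "(x, y) \<in> E" for x y
    proof -
      have xy: "x \<in> space M" "y \<in> space M" using sets.sets_into_space[OF E_sets] that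
        by (auto simp: space_pair_measure)
      then have "(\<psi> x, \<psi> y) \<in> E'" using that \<theta>\<psi> by (simp add: E'_def \<Theta>_def)
      with U(4) have "\<psi> x \<in> U \<longleftrightarrow> \<psi> y \<in> U" by blast
      then show ?thesis using xy by (simp add: A_def)
    qed
    ultimately have "A \<in> invariant_universal_sets M E"
      by (auto simp: invariant_universal_sets_def indicator_def)
    from V_ge[OF this] have "measure \<mu> A - measure \<nu> A \<le> ?V" using A sets by simp
    moreover have "B.left.prob C \<ge> 1 - measure \<mu> A"
    proof -
      have "B.left.prob (- U) \<le> B.left.prob C"
        using U(2) CD(1) by (intro B.left.finite_measure_mono) auto
      moreover have "B.left.prob (- U) = 1 - B.left.prob U"
        using B.left.prob_compl[of U] U(1) by (simp add: Compl_eq_Diff_UNIV)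
      ultimately show ?thesis using m\<mu>[OF U(1)] by (simp add: A_def)
    qed
    moreover have "B.right.prob D \<ge> measure \<nu> A"
    proof -
      have "B.right.prob U \<le> B.right.prob D"
        using U(3) CD(2) by (intro B.right.finite_measure_mono) auto
      then show ?thesis using m\<nu>[OF U(1)] by (simp add: A_def)
    qed
    ultimately show "1 - ?V \<le> B.cost X" by (simp add: X B.cost_def)
  qed
  with t have "t < B.capacity E'" by simp
  from B.capacity_duality[OF E'_borel this]
  obtain Q where Q: "prob_space Q" "sets Q = sets borel" "t \<le> measure Q E'"
    and marg: "\<And>A. A \<in> sets borel \<Longrightarrow> measure Q (A \<times> UNIV) = B.left.prob A"
      "\<And>A. A \<in> sets borel \<Longrightarrow> measure Q (UNIV \<times> A) = B.right.prob A"
    by blast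
  interpret Q: prob_space Q by fact
  have \<Theta>_Q: "\<Theta> \<in> measurable Q (M \<Otimes>\<^sub>M M)" using \<Theta> unfolding measurable_cong_sets[OF Q(2) refl] .
  have space_Q: "space Q = UNIV" using sets_eq_imp_space_eq[OF Q(2)] by simp
  define P where "P = distr Q (M \<Otimes>\<^sub>M M) \<Theta>"
  have P_eq: "measure P S = measure Q (\<Theta> -` S)" if "S \<in> sets (M \<Otimes>\<^sub>M M)" for S
    using measure_distr[OF \<Theta>_Q that] by (simp add: P_def space_Q)
  have \<theta>_A: "\<theta> -` A \<in> sets borel" if "A \<in> sets M" for A
    using measurable_sets[OF \<theta> that] by simp
  have \<psi>\<theta>: "\<psi> -` (\<theta> -` A) \<inter> space M = A" if "A \<in> sets M" for A
    using \<theta>\<psi> sets.sets_into_space[OF that] by auto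
  have "P \<in> couplings M \<mu> \<nu>"
    unfolding couplings_def
  proof (intro CollectI conjI ballI)
    show "P \<in> space (prob_algebra (M \<Otimes>\<^sub>M M))"
      using Q.prob_space_distr[OF \<Theta>_Q] by (simp add: space_prob_algebra P_def)
    fix A assume A: "A \<in> sets M"
    have "measure P (A \<times> space M) = measure Q (\<Theta> -` (A \<times> space M))" using A by (intro P_eq) auto
    also have "\<Theta> -` (A \<times> space M) = (\<theta> -` A) \<times> UNIV" using \<theta>_space by (auto simp: \<Theta>_def)
    finally show "measure P (A \<times> space M) = measure \<mu> A"
      using marg(1)[OF \<theta>_A[OF A]] m\<mu>[OF \<theta>_A[OF A]] \<psi>\<theta>[OF A] by simp
    have "measure P (space M \<times> A) = measure Q (\<Theta> -` (space M \<times> A))" using A by (intro P_eq) auto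
    also have "\<Theta> -` (space M \<times> A) = UNIV \<times> (\<theta> -` A)" using \<theta>_space by (auto simp: \<Theta>_def)
    finally show "measure P (space M \<times> A) = measure \<nu> A"
      using marg(2)[OF \<theta>_A[OF A]] m\<nu>[OF \<theta>_A[OF A]] \<psi>\<theta>[OF A] by simp
  qed
  moreover have "t \<le> measure P E" using Q(3) P_eq[OF E_sets] by (simp add: E'_def)
  ultimately show ?thesis by blast
qed

theorem theorem2:
  fixes M :: "'a measure" and E :: "('a \<times> 'a) set" and \<mu> \<nu> :: "'a measure"
  assumes "standard_borel_space M"
    and "measurable_equiv M E"
    and "\<mu> \<in> space (prob_algebra M)" and "\<nu> \<in> space (prob_algebra M)"
  shows "(INF P\<in>couplings M \<mu> \<nu>. 1 - measure P E)
           = variation_dist (invariant_universal_sets M E) \<mu> \<nu>"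
proof (rule antisym)
  let ?V = "variation_dist (invariant_universal_sets M E) \<mu> \<nu>"
  note coupling = near_optimal_coupling[OF assms]
  show "(INF P\<in>couplings M \<mu> \<nu>. 1 - measure P E) \<le> ?V"
  proof (rule field_le_epsilon)
    fix e :: real assume "0 < e"
    then obtain P where P: "P \<in> couplings M \<mu> \<nu>" "1 - ?V - e \<le> measure P E"
      using coupling[of "1 - ?V - e"] by auto
    have "bdd_below ((\<lambda>P. 1 - measure P E) ` couplings M \<mu> \<nu>)"
      by (rule bdd_belowI2[of _ 0])
        (auto simp: couplings_def space_prob_algebra prob_space.prob_le_1)
    then have "(INF P\<in>couplings M \<mu> \<nu>. 1 - measure P E) \<le> 1 - measure P E"
      using P(1) by (rule cINF_lower)
    then show "(INF P\<in>couplings M \<mu> \<nu>. 1 - measure P E) \<le> ?V + e" using P(2) by linarith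
  qed
  show "?V \<le> (INF P\<in>couplings M \<mu> \<nu>. 1 - measure P E)"
  proof (rule cINF_greatest)
    \<comment> \<open>\<open>- ?V\<close> is just some number below \<open>1 - ?V\<close>; only the
      existence of a coupling is taken from the lemma here.\<close>
    show "couplings M \<mu> \<nu> \<noteq> {}" using coupling[of "- ?V"] by auto
  next
    fix P assume P: "P \<in> couplings M \<mu> \<nu>"
    show "?V \<le> 1 - measure P E"
      unfolding variation_dist_def
    proof (rule cSUP_least)
      have "{} \<in> invariant_universal_sets M E"
        by (auto simp: invariant_universal_sets_def universal_sets_def)
      then show "invariant_universal_sets M E \<noteq> {}" by blast
    qed (rule coupling_bound[OF assms(2-4) P])
  qed
qed

end
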